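(* All idempotent states on $SO_0(3)$ arise as restrictions of idempotent states on $SU_0(2)$. Moreover $\phi_n|_{C(SO_0(3))}=\phi_{2n}|_{C(SO_0(3))}$ for every odd integer $n\ge 1$.
   Context: $\mathrm{Pol}(SU_0(2))$ is the $*$-bialgebra generated by $\alpha,\gamma$ with relations $\alpha\gamma=\alpha\gamma^*=0$, $\gamma\gamma^*=\gamma^*\gamma$, $\alpha^*\alpha+\gamma^*\gamma=1$, $\alpha\alpha^*=1$, coproduct $\Delta(\alpha)=\alpha\otimes\alpha$, $\Delta(\gamma)=\gamma\otimes\alpha+\alpha^*\otimes\gamma$, counit $\varepsilon(\alpha)=1$, $\varepsilon(\gamma)=0$. $C(SU_0(2))$ is its universal enveloping $C^*$-algebra with the extended coproduct. $\mathrm{Pol}(SO_0(3))$ is the unital $*$-subalgebra of $\mathrm{Pol}(SU_0(2))$ generated by $\alpha^2,\gamma^2,\gamma\alpha,\gamma^*\alpha,\gamma^*\gamma$, i.e. $\mathrm{span}\{(\alpha^* )^r\gamma^k\alpha^s,(\alpha^* )^r(\gamma^* )^k\alpha^s:r,k,s\in\mathbb{Z}_+,\ r+k+s\text{ even}\}$; it is a sub-bialgebra, and $C(SO_0(3))$ is its norm closure in $C(SU_0(2))$, with the restricted coproduct. An idempotent state on a $C^*$-bialgebra $(\mathsf{A},\Delta)$ is a state $\phi$ with $(\phi\otimes\phi)\circ\Delta=\phi$. For $n\in\mathbb{N}=\{1,2,\dots\}$, $\phi_n$ is the idempotent state on $C(SU_0(2))$ given by $\phi_n(x)=\frac1n\sum_{z^n=1}j(x)(z)$,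 where $j:C(SU_0(2))\to C(U(1))$ is the unital $*$-homomorphism with $\alpha\mapsto w$ (the coordinate function on $U(1)$) and $\gamma\mapsto0$; i.e. $\phi_1$ is the counit and, for $n\ge2$, $\phi_n$ is induced by the Haar state of the quantum subgroup $\mathbb{Z}_n$. *)

theory Defs
  imports "HOL-Analysis.Analysis" "HOL-Library.Poly_Mapping"
begin


class scaleC =
  fixes scaleC :: "complex \<Rightarrow> 'a \<Rightarrow> 'a"  (infixr \<open>*\<^sub>C\<close> 75)

text \<open>
  Unital complex \<open>*\<close>-algebras. The zero algebra is not excluded, so that quotients by arbitrary
  ideals are instances.
\<close>

class star_algebra = ring + monoid_mult + scaleC +
  fixes star :: "'a \<Rightarrow> 'a"
  assumes scaleC_add_right: "c *\<^sub>C (x + y) = c *\<^sub>C x + c *\<^sub>C y"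
    and scaleC_add_left: "(c + d) *\<^sub>C x = c *\<^sub>C x + d *\<^sub>C x"
    and scaleC_scaleC: "c *\<^sub>C d *\<^sub>C x = (c * d) *\<^sub>C x"
    and scaleC_one: "1 *\<^sub>C x = x"
    and mult_scaleC_left: "(c *\<^sub>C x) * y = c *\<^sub>C (x * y)"
    and mult_scaleC_right: "x * (c *\<^sub>C y) = c *\<^sub>C (x * y)"
    and star_star: "star (star x) = x"
    and star_add: "star (x + y) = star x + star y"
    and star_scaleC: "star (c *\<^sub>C x) = cnj c *\<^sub>C star x"
    and star_mult: "star (x * y) = star y * star x"
begin

lemma scaleC_zero_right: "c *\<^sub>C 0 = 0"
  using scaleC_add_right[of c 0 0] by simp

lemma scaleC_zero_left: "0 *\<^sub>C x = 0"
  using scaleC_add_left[of 0 0 x] by simp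

lemma scaleC_minus_one: "(- 1) *\<^sub>C x = - x"
  using scaleC_add_left[of "- 1" 1 x]
  by (simp add: scaleC_zero_left scaleC_one eq_neg_iff_add_eq_0)

lemma scaleC_uminus: "c *\<^sub>C (- x) = - (c *\<^sub>C x)"
  using scaleC_add_right[of c x "- x"]
  by (simp add: scaleC_zero_right minus_unique)

lemma scaleC_diff_right: "c *\<^sub>C (x - y) = c *\<^sub>C x - c *\<^sub>C y"
  using scaleC_add_right[of c x "- y"] by (simp add: scaleC_uminus)

lemma star_zero: "star 0 = 0"
  using star_add[of 0 0] by simp

lemma star_uminus: "star (- x) = - star x"
  using star_add[of x "- x"] by (simp add: star_zero minus_unique)

lemma star_diff: "star (x - y) = star x - star y"
  using star_add[of x "- y"] by (simp add: star_uminus)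

lemma star_one: "star 1 = 1"
  using star_mult[of "star 1" 1] star_star by (metis mult_1_left mult_1_right)

end

instantiation complex :: star_algebra
begin
definition "c *\<^sub>C (x::complex) = c * x"
definition "star (x::complex) = cnj x"
instance
  by standard (simp_all add: scaleC_complex_def star_complex_def algebra_simps)
end

definition unital_star_hom :: "('a::star_algebra \<Rightarrow> 'b::star_algebra) \<Rightarrow> bool" where
  "unital_star_hom f \<longleftrightarrow>
     (\<forall>x y. f (x + y) = f x + f y) \<and> (\<forall>c x. f (c *\<^sub>C x) = c *\<^sub>C f x) \<and>
     (\<forall>x y. f (x * y) = f x * f y) \<and> (\<forall>x. f (star x) = star (f x)) \<and> f 1 = 1"

lemma unital_star_homD:
  assumes "unital_star_hom f"
  shows "f (x + y) = f x + f y" "f (c *\<^sub>C x) = c *\<^sub>C f x" "f (x * y) = f x * f y"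
    "f (star x) = star (f x)" "f 1 = 1" "f 0 = 0" "f (- x) = - f x" "f (x - y) = f x - f y"
proof -
  show 1: "f (x + y) = f x + f y" "f (c *\<^sub>C x) = c *\<^sub>C f x" "f (x * y) = f x * f y"
    "f (star x) = star (f x)" "f 1 = 1" for x y c
    using assms unfolding unital_star_hom_def by auto
  show "f 0 = 0" using 1(2)[of 0 0] by (simp add: scaleC_zero_left)
  show 2: "f (- x) = - f x" for x using 1(2)[of "- 1" x] by (simp add: scaleC_minus_one)
  show "f (x - y) = f x - f y" using 1(1)[of x "- y"] 2[of y] by simp
qed

inductive_set star_subalgebra :: "'a::star_algebra set \<Rightarrow> 'a set" for S where
  gen: "x \<in> S \<Longrightarrow> x \<in> star_subalgebra S"
| one: "1 \<in> star_subalgebra S"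
| add: "x \<in> star_subalgebra S \<Longrightarrow> y \<in> star_subalgebra S \<Longrightarrow> x + y \<in> star_subalgebra S"
| scale: "x \<in> star_subalgebra S \<Longrightarrow> c *\<^sub>C x \<in> star_subalgebra S"
| mult: "x \<in> star_subalgebra S \<Longrightarrow> y \<in> star_subalgebra S \<Longrightarrow> x * y \<in> star_subalgebra S"
| star: "x \<in> star_subalgebra S \<Longrightarrow> star x \<in> star_subalgebra S"

text \<open>
  The two-sided \<open>*\<close>-closed ideal generated by \<open>S\<close>; it is closed under scalars because the algebra is unital.
\<close>

inductive_set star_ideal :: "'a::star_algebra set \<Rightarrow> 'a set" for S where
  gen: "x \<in> S \<Longrightarrow> x \<in> star_ideal S"
| zero: "0 \<in> star_ideal S"
| add: "x \<in> star_ideal S \<Longrightarrow> y \<in> star_ideal S \<Longrightarrow> x + y \<in> star_ideal S"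
| left: "x \<in> star_ideal S \<Longrightarrow> a * x \<in> star_ideal S"
| right: "x \<in> star_ideal S \<Longrightarrow> x * a \<in> star_ideal S"
| star: "x \<in> star_ideal S \<Longrightarrow> star x \<in> star_ideal S"

lemma star_ideal_scaleC: "x \<in> star_ideal S \<Longrightarrow> c *\<^sub>C x \<in> star_ideal S"
  using star_ideal.left[of x S "c *\<^sub>C 1"] by (simp add: mult_scaleC_left)

lemma star_ideal_uminus: "x \<in> star_ideal S \<Longrightarrow> - x \<in> star_ideal S"
  using star_ideal_scaleC[of x S "- 1"] by (simp add: scaleC_minus_one)

lemma star_ideal_diff: "x \<in> star_ideal S \<Longrightarrow> y \<in> star_ideal S \<Longrightarrow> x - y \<in> star_ideal S"
  using star_ideal.add[of x S "- y"] by (simp add: star_ideal_uminus)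

lemma star_ideal_equivp: "equivp (\<lambda>x y. x - y \<in> star_ideal S)"
proof (rule equivpI)
  show "reflp (\<lambda>x y. x - y \<in> star_ideal S)"
    by (rule reflpI) (simp add: star_ideal.zero)
  show "symp (\<lambda>x y. x - y \<in> star_ideal S)"
    by (rule sympI) (use star_ideal_uminus in fastforce)
  show "transp (\<lambda>x y. x - y \<in> star_ideal S)"
  proof (rule transpI)
    fix x y z assume "x - y \<in> star_ideal S" "y - z \<in> star_ideal S"
    from star_ideal.add[OF this] show "x - z \<in> star_ideal S" by simp
  qed
qed

lemma star_ideal_add_cong:
  assumes "x - x' \<in> star_ideal S" "y - y' \<in> star_ideal S"
  shows "(x + y) - (x' + y') \<in> star_ideal S"
  using star_ideal.add[OF assms] by (simp add: algebra_simps)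

lemma star_ideal_diff_cong:
  assumes "x - x' \<in> star_ideal S" "y - y' \<in> star_ideal S"
  shows "(x - y) - (x' - y') \<in> star_ideal S"
  using star_ideal_diff[OF assms] by (simp add: algebra_simps)

lemma star_ideal_uminus_cong:
  assumes "x - x' \<in> star_ideal S"
  shows "- x - - x' \<in> star_ideal S"
  using star_ideal_uminus[OF assms] by (simp add: algebra_simps)

lemma star_ideal_mult_cong:
  assumes "x - x' \<in> star_ideal S" "y - y' \<in> star_ideal S"
  shows "x * y - x' * y' \<in> star_ideal S"
  using star_ideal.add[OF star_ideal.right[OF assms(1), of y] star_ideal.left[OF assms(2), of x']]
  by (simp add: algebra_simps)

lemma star_ideal_scaleC_cong:
  assumes "x - x' \<in> star_ideal S"
  shows "c *\<^sub>C x - c *\<^sub>C x' \<in> star_ideal S"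
  using star_ideal_scaleC[OF assms] by (simp add: scaleC_diff_right)

lemma star_ideal_star_cong:
  assumes "x - x' \<in> star_ideal S"
  shows "star x - star x' \<in> star_ideal S"
  using star_ideal.star[OF assms] by (simp add: star_diff)

lemmas star_ideal_congs = star_ideal_add_cong star_ideal_diff_cong star_ideal_uminus_cong
  star_ideal_mult_cong star_ideal_scaleC_cong star_ideal_star_cong

text \<open>
  For a monoid \<open>M\<close> (written additively, as required by \<^typ>\<open>'a \<Rightarrow>\<^sub>0 'b\<close>) with an involution \<open>inv_op\<close>,
  the monoid algebra of \<open>M\<close> is a \<open>*\<close>-algebra.
\<close>

class involutive_monoid = monoid_add +
  fixes inv_op :: "'a \<Rightarrow> 'a"
  assumes inv_op_inv_op: "inv_op (inv_op m) = m"
    and inv_op_add: "inv_op (m + n) = inv_op n + inv_op m"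

lemma inj_inv_op: "inj (inv_op :: 'm::involutive_monoid \<Rightarrow> 'm)"
  by (metis injI inv_op_inv_op)

lemma poly_mapping_add_induct [case_names zero single add]:
  fixes p :: "'m \<Rightarrow>\<^sub>0 'c::monoid_add"
  assumes "P 0" "\<And>m c. P (Poly_Mapping.single m c)" "\<And>p q. P p \<Longrightarrow> P q \<Longrightarrow> P (p + q)"
  shows "P p"
proof (induction p rule: update_induct)
  case const
  then show ?case by (fact assms(1))
next
  case (update f a b)
  have "Poly_Mapping.update a b f = f + Poly_Mapping.single a b"
    using update(1)
    by (intro poly_mapping_eqI)
       (auto simp: lookup_update lookup_add lookup_single when_def in_keys_iff)
  then show ?case using assms(2,3) update by simp
qed

instantiation poly_mapping :: (involutive_monoid, "{star_algebra, comm_ring_1}") star_algebra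
begin

definition scaleC_poly_mapping :: "complex \<Rightarrow> ('a \<Rightarrow>\<^sub>0 'b) \<Rightarrow> ('a \<Rightarrow>\<^sub>0 'b)" where
  "c *\<^sub>C p = Poly_Mapping.map (\<lambda>x. c *\<^sub>C x) p"

definition star_poly_mapping :: "('a \<Rightarrow>\<^sub>0 'b) \<Rightarrow> ('a \<Rightarrow>\<^sub>0 'b)" where
  "star p = Poly_Mapping.map star (Poly_Mapping.map_key inv_op p)"

lemma lookup_scaleC: "Poly_Mapping.lookup (c *\<^sub>C p) m = c *\<^sub>C Poly_Mapping.lookup p m"
  for p :: "'a \<Rightarrow>\<^sub>0 'b"
  by (simp add: scaleC_poly_mapping_def Poly_Mapping.map.rep_eq when_def scaleC_zero_right)

lemma lookup_star: "Poly_Mapping.lookup (star p) m = star (Poly_Mapping.lookup p (inv_op m))"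
  for p :: "'a \<Rightarrow>\<^sub>0 'b"
  by (simp add: star_poly_mapping_def Poly_Mapping.map.rep_eq when_def star_zero
      map_key.rep_eq[OF inj_inv_op])

lemma scaleC_single: "c *\<^sub>C Poly_Mapping.single m (x::'b) = Poly_Mapping.single m (c *\<^sub>C x)"
  for m :: 'a
  by (intro poly_mapping_eqI) (simp add: lookup_scaleC lookup_single when_def scaleC_zero_right)

lemma star_single: "star (Poly_Mapping.single m (x::'b)) = Poly_Mapping.single (inv_op m) (star x)"
  for m :: 'a
  by (intro poly_mapping_eqI)
     (auto simp add: lookup_star lookup_single when_def star_zero inv_op_inv_op)

instance
proof
  fix c d :: complex and p q :: "'a \<Rightarrow>\<^sub>0 'b"
  show add: "c *\<^sub>C (p + q) = c *\<^sub>C p + c *\<^sub>C q" for c and p q :: "'a \<Rightarrow>\<^sub>0 'b"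
    by (intro poly_mapping_eqI) (simp add: lookup_scaleC lookup_add scaleC_add_right)
  show "(c + d) *\<^sub>C p = c *\<^sub>C p + d *\<^sub>C p"
    by (intro poly_mapping_eqI) (simp add: lookup_scaleC lookup_add scaleC_add_left)
  show "c *\<^sub>C d *\<^sub>C p = (c * d) *\<^sub>C p"
    by (intro poly_mapping_eqI) (simp add: lookup_scaleC scaleC_scaleC)
  show "1 *\<^sub>C p = p"
    by (intro poly_mapping_eqI) (simp add: lookup_scaleC scaleC_one)
  have zero: "c *\<^sub>C 0 = (0 :: 'a \<Rightarrow>\<^sub>0 'b)"
    by (intro poly_mapping_eqI) (simp add: lookup_scaleC scaleC_zero_right)
  have s1: "(c *\<^sub>C Poly_Mapping.single m x) * q = c *\<^sub>C (Poly_Mapping.single m x * q)"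
    for m :: 'a and x :: 'b and q
    by (induction q rule: poly_mapping_add_induct)
       (simp_all add: zero scaleC_single mult_single mult_scaleC_left add distrib_left)
  show "(c *\<^sub>C p) * q = c *\<^sub>C (p * q)"
    by (induction p rule: poly_mapping_add_induct)
       (simp_all add: zero s1 add distrib_right)
  have s2: "Poly_Mapping.single m x * (c *\<^sub>C q) = c *\<^sub>C (Poly_Mapping.single m x * q)"
    for m :: 'a and x :: 'b and q
    by (induction q rule: poly_mapping_add_induct)
       (simp_all add: zero scaleC_single mult_single mult_scaleC_right add distrib_left)
  show "p * (c *\<^sub>C q) = c *\<^sub>C (p * q)"
    by (induction p rule: poly_mapping_add_induct)
       (simp_all add: zero s2 add distrib_right)
  show "star (star p) = p"
    by (intro poly_mapping_eqI) (simp add: lookup_star star_star inv_op_inv_op)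
  show sadd: "star (p + q) = star p + star q" for p q :: "'a \<Rightarrow>\<^sub>0 'b"
    by (intro poly_mapping_eqI) (simp add: lookup_star lookup_add star_add)
  show "star (c *\<^sub>C p) = cnj c *\<^sub>C star p"
    by (intro poly_mapping_eqI) (simp add: lookup_star lookup_scaleC star_scaleC)
  have szero: "star 0 = (0 :: 'a \<Rightarrow>\<^sub>0 'b)"
    by (intro poly_mapping_eqI) (simp add: lookup_star star_zero)
  have s3: "star (Poly_Mapping.single m x * q) = star q * star (Poly_Mapping.single m x)"
    for m :: 'a and x :: 'b and q
    by (induction q rule: poly_mapping_add_induct)
       (simp_all add: szero star_single mult_single inv_op_add star_mult mult.commute
         sadd distrib_left distrib_right)
  show "star (p * q) = star q * star p"
    by (induction p rule: poly_mapping_add_induct)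
       (simp_all add: szero s3 sadd distrib_left distrib_right)
qed

end

text \<open>
  The letter \<open>(g, False)\<close> stands for the generator \<open>g\<close>, the letter \<open>(g, True)\<close> for \<open>g\<^sup>*\<close>.
\<close>

datatype 'g word = Word (letters: "('g \<times> bool) list")

instantiation word :: (type) involutive_monoid
begin
definition "0 = Word []"
definition "v + w = Word (letters v @ letters w)"
definition "inv_op w = Word (rev (map (\<lambda>(g, s). (g, \<not> s)) (letters w)))"
instance
  by standard (auto simp: zero_word_def plus_word_def inv_op_word_def rev_map case_prod_unfold
      comp_def intro: word.expand)
end

type_synonym 'g free_star_algebra = "'g word \<Rightarrow>\<^sub>0 complex"

definition free_gen :: "'g \<Rightarrow> 'g free_star_algebra" where
  "free_gen g = Poly_Mapping.single (Word [(g, False)]) 1"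

datatype su_generator = Gen_alpha | Gen_gamma

text \<open>
  Each listed element is set to zero in \<open>Pol(SU\<^sub>0(2))\<close>.
\<close>

definition su_relators :: "su_generator free_star_algebra set" where
  "su_relators =
    (let a = free_gen Gen_alpha; c = free_gen Gen_gamma in
     {a * c, a * star c, c * star c - star c * c, star a * a + star c * c - 1, a * star a - 1})"

quotient_type pol_su = "su_generator free_star_algebra" /
  "\<lambda>x y. x - y \<in> star_ideal su_relators"
  by (rule star_ideal_equivp)

instantiation pol_su :: star_algebra
begin
lift_definition zero_pol_su :: pol_su is 0 .
lift_definition one_pol_su :: pol_su is 1 .
lift_definition plus_pol_su :: "pol_su \<Rightarrow> pol_su \<Rightarrow> pol_su" is "(+)" by (rule star_ideal_congs)
lift_definition minus_pol_su :: "pol_su \<Rightarrow> pol_su \<Rightarrow> pol_su" is "(-)" by (rule star_ideal_congs)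
lift_definition uminus_pol_su :: "pol_su \<Rightarrow> pol_su" is uminus by (rule star_ideal_congs)
lift_definition times_pol_su :: "pol_su \<Rightarrow> pol_su \<Rightarrow> pol_su" is "(*)" by (rule star_ideal_congs)
lift_definition scaleC_pol_su :: "complex \<Rightarrow> pol_su \<Rightarrow> pol_su" is scaleC
  by (rule star_ideal_congs)
lift_definition star_pol_su :: "pol_su \<Rightarrow> pol_su" is star by (rule star_ideal_congs)
instance
  by standard
    (transfer; simp add: star_ideal.zero algebra_simps scaleC_add_right scaleC_add_left
      scaleC_scaleC scaleC_one mult_scaleC_left mult_scaleC_right star_star star_add star_scaleC
      star_mult)+
end

lift_definition su_alpha :: pol_su is "free_gen Gen_alpha" .
lift_definition su_gamma :: pol_su is "free_gen Gen_gamma" .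

lemma pol_su_relations:
  "su_alpha * su_gamma = 0" "su_alpha * star su_gamma = 0"
  "su_gamma * star su_gamma = star su_gamma * su_gamma"
  "star su_alpha * su_alpha + star su_gamma * su_gamma = 1" "su_alpha * star su_alpha = 1"
  by (transfer; rule star_ideal.gen; simp add: su_relators_def Let_def)+

text \<open>
  The algebraic tensor product is the algebra of the multiplicative monoid of pairs, modulo the
  bilinearity relations. The linear span of these relations is already a \<open>*\<close>-ideal, so the underlying
  vector space is the usual tensor product.
\<close>

datatype ('a, 'b) elem_tensor = Elem_tensor (tfst: 'a) (tsnd: 'b)

instantiation elem_tensor :: (star_algebra, star_algebra) involutive_monoid
begin
definition "0 = Elem_tensor 1 1"
definition "s + t = Elem_tensor (tfst s * tfst t) (tsnd s * tsnd t)"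
definition "inv_op s = Elem_tensor (star (tfst s)) (star (tsnd s))"
instance
  by standard (simp_all add: zero_elem_tensor_def plus_elem_tensor_def inv_op_elem_tensor_def
      mult.assoc star_star star_mult)
end

definition tensor_relators ::
    "(('a::star_algebra, 'b::star_algebra) elem_tensor \<Rightarrow>\<^sub>0 complex) set" where
  "tensor_relators =
    (let e = (\<lambda>a b. Poly_Mapping.single (Elem_tensor a b) 1) in
     {e (a + a') b - e a b - e a' b |a a' b. True} \<union>
     {e a (b + b') - e a b - e a b' |a b b'. True} \<union>
     {e (c *\<^sub>C a) b - c *\<^sub>C e a b |c a b. True} \<union>
     {e a (c *\<^sub>C b) - c *\<^sub>C e a b |c a b. True})"

quotient_type (overloaded) ('a, 'b) alg_tensor =
    "('a::star_algebra, 'b::star_algebra) elem_tensor \<Rightarrow>\<^sub>0 complex" /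
    "\<lambda>x y. x - y \<in> star_ideal tensor_relators"
  by (rule star_ideal_equivp)

instantiation alg_tensor :: (star_algebra, star_algebra) star_algebra
begin
lift_definition zero_alg_tensor :: "('a, 'b) alg_tensor" is 0 .
lift_definition one_alg_tensor :: "('a, 'b) alg_tensor" is 1 .
lift_definition plus_alg_tensor :: "('a, 'b) alg_tensor \<Rightarrow> ('a, 'b) alg_tensor \<Rightarrow> ('a, 'b) alg_tensor"
  is "(+)" by (rule star_ideal_congs)
lift_definition minus_alg_tensor :: "('a, 'b) alg_tensor \<Rightarrow> ('a, 'b) alg_tensor \<Rightarrow> ('a, 'b) alg_tensor"
  is "(-)" by (rule star_ideal_congs)
lift_definition uminus_alg_tensor :: "('a, 'b) alg_tensor \<Rightarrow> ('a, 'b) alg_tensor"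
  is uminus by (rule star_ideal_congs)
lift_definition times_alg_tensor :: "('a, 'b) alg_tensor \<Rightarrow> ('a, 'b) alg_tensor \<Rightarrow> ('a, 'b) alg_tensor"
  is "(*)" by (rule star_ideal_congs)
lift_definition scaleC_alg_tensor :: "complex \<Rightarrow> ('a, 'b) alg_tensor \<Rightarrow> ('a, 'b) alg_tensor"
  is scaleC by (rule star_ideal_congs)
lift_definition star_alg_tensor :: "('a, 'b) alg_tensor \<Rightarrow> ('a, 'b) alg_tensor"
  is star by (rule star_ideal_congs)
instance
  by standard
    (transfer; simp add: star_ideal.zero algebra_simps scaleC_add_right scaleC_add_left
      scaleC_scaleC scaleC_one mult_scaleC_left mult_scaleC_right star_star star_add star_scaleC
      star_mult)+
end

lift_definition pure_tensor :: "'a::star_algebra \<Rightarrow> 'b::star_algebra \<Rightarrow> ('a, 'b) alg_tensor"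
  is "\<lambda>a b. Poly_Mapping.single (Elem_tensor a b) 1" .


definition (in star_algebra) cstar_seminorm :: "('a \<Rightarrow> real) \<Rightarrow> bool" where
  "cstar_seminorm p \<longleftrightarrow>
     (\<forall>x y. p (x + y) \<le> p x + p y) \<and> (\<forall>c x. p (c *\<^sub>C x) = cmod c * p x) \<and>
     (\<forall>x y. p (x * y) \<le> p x * p y) \<and> (\<forall>x. p (star x * x) = (p x)\<^sup>2)"

lemma cstar_seminormD:
  assumes "cstar_seminorm p"
  shows cstar_seminorm_add: "p (x + y) \<le> p x + p y"
    and cstar_seminorm_scaleC: "p (c *\<^sub>C x) = cmod c * p x"
    and cstar_seminorm_mult: "p (x * y) \<le> p x * p y"
    and cstar_seminorm_star_mult: "p (star x * x) = (p x)\<^sup>2"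
    and cstar_seminorm_zero: "p 0 = 0"
    and cstar_seminorm_uminus: "p (- x) = p x"
    and cstar_seminorm_nonneg: "0 \<le> p x"
    and cstar_seminorm_star: "p (star x) = p x"
    and cstar_seminorm_one: "p 1 \<le> 1"
proof -
  show add: "p (x + y) \<le> p x + p y" and sc: "p (c *\<^sub>C x) = cmod c * p x"
    and mult: "p (x * y) \<le> p x * p y" and sm: "p (star x * x) = (p x)\<^sup>2" for x y c
    using assms unfolding cstar_seminorm_def by auto
  show zero: "p 0 = 0" using sc[of 0 0] by (simp add: scaleC_zero_left)
  show um: "p (- x) = p x" for x using sc[of "- 1" x] by (simp add: scaleC_minus_one)
  show nn: "0 \<le> p x" for x using add[of x "- x"] by (simp add: zero um)
  have st: "p x \<le> p (star x)" for x
  proof (cases "p x = 0")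
    case False
    then have "p x > 0" using nn[of x] by simp
    moreover have "p x * p x \<le> p (star x) * p x"
      using mult[of "star x" x] sm[of x] by (simp add: power2_eq_square)
    ultimately show ?thesis by simp
  qed (use nn in simp)
  show "p (star x) = p x" using st[of x] st[of "star x"] by (simp add: star_star)
  have "p 1 = p 1 * p 1" using sm[of 1] by (simp add: star_one power2_eq_square)
  then show "p 1 \<le> 1" by (metis mult_cancel_left1 order_refl zero_le_one)
qed

lemma cstar_seminorm_diff:
  assumes "cstar_seminorm p"
  shows "p (x - y) \<le> p x + p y"
  using cstar_seminorm_add[OF assms, of x "- y"] cstar_seminorm_uminus[OF assms, of y] by simp

lemma cstar_seminorm_commute:
  assumes "cstar_seminorm p"
  shows "p (x - y) = p (y - x)"
  using cstar_seminorm_uminus[OF assms, of "x - y"] by simp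

lemma cstar_seminorm_zero_map: "cstar_seminorm (\<lambda>_. 0)"
  by (simp add: cstar_seminorm_def)

lemma cstar_seminorm_SUP:
  assumes P: "P \<noteq> {}" "\<And>p. p \<in> P \<Longrightarrow> cstar_seminorm p"
    and bdd: "\<And>x. \<exists>M. \<forall>p\<in>P. p x \<le> M"
  shows "cstar_seminorm (\<lambda>x. SUP p\<in>P. p x)"
proof -
  let ?S = "\<lambda>x. SUP p\<in>P. p x"
  have b: "bdd_above ((\<lambda>p. p x) ` P)" for x using bdd[of x] by (auto simp: bdd_above_def)
  have up: "p x \<le> ?S x" if "p \<in> P" for p x using that b by (rule cSUP_upper)
  have least: "?S x \<le> M" if "\<And>p. p \<in> P \<Longrightarrow> p x \<le> M" for x M
    using P(1) that by (rule cSUP_least)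
  obtain p0 where p0: "p0 \<in> P" using P(1) by blast
  have nn: "0 \<le> ?S x" for x
    using up[OF p0, of x] cstar_seminorm_nonneg[OF P(2)[OF p0], of x] by linarith
  show ?thesis unfolding cstar_seminorm_def
  proof (intro conjI allI)
    fix x y :: 'a and c :: complex
    show "?S (x + y) \<le> ?S x + ?S y"
    proof (rule least)
      fix p assume p: "p \<in> P"
      show "p (x + y) \<le> ?S x + ?S y"
        using cstar_seminorm_add[OF P(2)[OF p], of x y] up[OF p, of x] up[OF p, of y] by linarith
    qed
    show "?S (c *\<^sub>C x) = cmod c * ?S x"
    proof (rule antisym)
      show "?S (c *\<^sub>C x) \<le> cmod c * ?S x"
        by (rule least) (simp add: cstar_seminorm_scaleC[OF P(2)] mult_left_mono up)
      show "cmod c * ?S x \<le> ?S (c *\<^sub>C x)"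
      proof (cases "c = 0")
        case False
        have "?S x \<le> ?S (c *\<^sub>C x) / cmod c"
        proof (rule least)
          fix p assume p: "p \<in> P"
          show "p x \<le> ?S (c *\<^sub>C x) / cmod c"
            using up[OF p, of "c *\<^sub>C x"] False
            by (simp add: cstar_seminorm_scaleC[OF P(2)[OF p]] field_simps)
        qed
        then show ?thesis using False by (simp add: field_simps)
      qed (use nn in simp)
    qed
    show "?S (x * y) \<le> ?S x * ?S y"
    proof (rule least)
      fix p assume p: "p \<in> P"
      have "p (x * y) \<le> p x * p y" by (rule cstar_seminorm_mult[OF P(2)[OF p]])
      also have "\<dots> \<le> ?S x * ?S y"
        by (intro mult_mono up p nn cstar_seminorm_nonneg[OF P(2)[OF p]])
      finally show "p (x * y) \<le> ?S x * ?S y" .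
    qed
    show "?S (star x * x) = (?S x)\<^sup>2"
    proof (rule antisym)
      show "?S (star x * x) \<le> (?S x)\<^sup>2"
        by (rule least) (simp add: cstar_seminorm_star_mult[OF P(2)] power_mono up
            cstar_seminorm_nonneg[OF P(2)])
      have "?S x \<le> sqrt (?S (star x * x))"
      proof (rule least)
        fix p assume p: "p \<in> P"
        show "p x \<le> sqrt (?S (star x * x))"
          using up[OF p, of "star x * x"]
          by (intro real_le_rsqrt) (simp add: cstar_seminorm_star_mult[OF P(2)[OF p]])
      qed
      then have "(?S x)\<^sup>2 \<le> (sqrt (?S (star x * x)))\<^sup>2" by (rule power_mono) (rule nn)
      then show "(?S x)\<^sup>2 \<le> ?S (star x * x)" using nn by simp
    qed
  qed
qed

lemma cstar_seminorm_comp: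
  assumes "cstar_seminorm p" "unital_star_hom h"
  shows "cstar_seminorm (\<lambda>x. p (h x))"
  using cstar_seminormD(1-4)[OF assms(1)]
  by (simp add: cstar_seminorm_def unital_star_homD[OF assms(2)])

class cstar_seminormed = star_algebra +
  fixes cnorm :: "'a \<Rightarrow> real"
  assumes cstar_seminorm_cnorm: "cstar_seminorm cnorm"

text \<open>
  Unital \<open>C\<^sup>*\<close>-algebras; as above, the zero algebra is not excluded.
\<close>

class cstar_algebra = star_algebra + real_normed_algebra + banach +
  assumes scaleR_scaleC: "r *\<^sub>R x = complex_of_real r *\<^sub>C x"
    and norm_scaleC: "norm (c *\<^sub>C x) = cmod c * norm x"
    and norm_star_mult: "norm (star x * x) = (norm x)\<^sup>2"

instance complex :: cstar_algebra
  by standard (auto simp: scaleC_complex_def star_complex_def scaleR_conv_of_real norm_mult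
      power2_eq_square)

lemma cstar_seminorm_norm: "cstar_seminorm (norm :: 'a::cstar_algebra \<Rightarrow> real)"
  by (simp add: cstar_seminorm_def norm_triangle_ineq norm_scaleC norm_mult_ineq norm_star_mult)

text \<open>
  The separated completion of a \<open>*\<close>-algebra with respect to a \<open>C\<^sup>*\<close>-seminorm: Cauchy sequences
  modulo sequences tending to zero.
\<close>

definition cnorm_Cauchy :: "(nat \<Rightarrow> 'a::cstar_seminormed) \<Rightarrow> bool" where
  "cnorm_Cauchy X \<longleftrightarrow> (\<forall>e>0. \<exists>N. \<forall>m\<ge>N. \<forall>n\<ge>N. cnorm (X m - X n) < e)"

definition completion_rel :: "(nat \<Rightarrow> 'a::cstar_seminormed) \<Rightarrow> (nat \<Rightarrow> 'a) \<Rightarrow> bool" where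
  "completion_rel X Y \<longleftrightarrow> cnorm_Cauchy X \<and> cnorm_Cauchy Y \<and> (\<lambda>n. cnorm (X n - Y n)) \<longlonglongrightarrow> 0"

lemmas cnorm_facts = cstar_seminormD[OF cstar_seminorm_cnorm]

lemma cnorm_minus_commute: "cnorm (x - y) = cnorm (y - x)" for x :: "'a::cstar_seminormed"
  by (rule cstar_seminorm_commute[OF cstar_seminorm_cnorm])

lemma cnorm_diff_triangle: "cnorm (x - z) \<le> cnorm (x - y) + cnorm (y - z)"
  for x :: "'a::cstar_seminormed"
  using cnorm_facts(1)[of "x - y" "y - z"] by simp

lemma cnorm_abs_diff: "\<bar>cnorm x - cnorm y\<bar> \<le> cnorm (x - y)" for x :: "'a::cstar_seminormed"
  using cnorm_facts(1)[of "x - y" y] cnorm_facts(1)[of "y - x" x] cnorm_minus_commute[of x y] by auto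

lemma cnorm_Cauchy_convergent:
  assumes "cnorm_Cauchy X"
  shows "(\<lambda>n. cnorm (X n)) \<longlonglongrightarrow> lim (\<lambda>n. cnorm (X n))"
proof -
  have "Cauchy (\<lambda>n. cnorm (X n))"
  proof (rule CauchyI)
    fix e :: real assume "0 < e"
    then obtain N where "\<forall>m\<ge>N. \<forall>n\<ge>N. cnorm (X m - X n) < e"
      using assms by (auto simp: cnorm_Cauchy_def)
    then show "\<exists>N. \<forall>m\<ge>N. \<forall>n\<ge>N. norm (cnorm (X m) - cnorm (X n)) < e"
      using cnorm_abs_diff by (metis order.strict_trans1 real_norm_def)
  qed
  then show ?thesis by (simp add: Cauchy_convergent_iff convergent_LIMSEQ_iff)
qed

lemma cnorm_Cauchy_bounded:
  assumes "cnorm_Cauchy X"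
  obtains M where "M > 0" "\<And>n. cnorm (X n) \<le> M"
proof -
  have "Bseq (\<lambda>n. cnorm (X n))"
    using cnorm_Cauchy_convergent[OF assms] by (intro convergent_imp_Bseq) (auto simp: convergent_def)
  then obtain M where "M > 0" "\<And>n. norm (cnorm (X n)) \<le> M" by (auto simp: Bseq_def)
  then show ?thesis using that[of M] by (simp add: cnorm_facts(7))
qed

lemma cnorm_Cauchy_const: "cnorm_Cauchy (\<lambda>_. x)"
  by (simp add: cnorm_Cauchy_def cnorm_facts(5))

lemma cnorm_Cauchy_Lipschitz:
  assumes "cnorm_Cauchy X" and L: "\<And>x y. cnorm (f x - f y) \<le> L * cnorm (x - y)"
  shows "cnorm_Cauchy (\<lambda>n. f (X n))"
  unfolding cnorm_Cauchy_def
proof (intro allI impI)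
  fix e :: real assume e: "e > 0"
  then have "e / (\<bar>L\<bar> + 1) > 0" by simp
  then obtain N where N: "\<forall>m\<ge>N. \<forall>n\<ge>N. cnorm (X m - X n) < e / (\<bar>L\<bar> + 1)"
    using assms(1) unfolding cnorm_Cauchy_def by blast
  show "\<exists>N. \<forall>m\<ge>N. \<forall>n\<ge>N. cnorm (f (X m) - f (X n)) < e"
  proof (intro exI allI impI)
    fix m n assume "m \<ge> N" "n \<ge> N"
    then have "cnorm (X m - X n) * (\<bar>L\<bar> + 1) < e" using N e by (simp add: field_simps)
    moreover have "L * cnorm (X m - X n) \<le> cnorm (X m - X n) * (\<bar>L\<bar> + 1)"
      using mult_right_mono[OF _ cnorm_facts(7)[of "X m - X n"], of L "\<bar>L\<bar> + 1"]
      by (simp add: mult.commute)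
    ultimately show "cnorm (f (X m) - f (X n)) < e" using L[of "X m" "X n"] by linarith
  qed
qed

lemma cnorm_Cauchy_add:
  assumes "cnorm_Cauchy X" "cnorm_Cauchy Y"
  shows "cnorm_Cauchy (\<lambda>n. X n + Y n)"
  unfolding cnorm_Cauchy_def
proof (intro allI impI)
  fix e :: real assume "e > 0"
  then have "e / 2 > 0" by simp
  then obtain N M where N: "\<forall>m\<ge>N. \<forall>n\<ge>N. cnorm (X m - X n) < e / 2"
    and M: "\<forall>m\<ge>M. \<forall>n\<ge>M. cnorm (Y m - Y n) < e / 2"
    using assms unfolding cnorm_Cauchy_def by meson
  have "cnorm (X m + Y m - (X n + Y n)) < e" if "m \<ge> max N M" "n \<ge> max N M" for m n
  proof -
    have "cnorm (X m - X n) < e / 2" "cnorm (Y m - Y n) < e / 2" using N M that by auto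
    then show ?thesis using cnorm_facts(1)[of "X m - X n" "Y m - Y n"] by (simp add: algebra_simps)
  qed
  then show "\<exists>N. \<forall>m\<ge>N. \<forall>n\<ge>N. cnorm (X m + Y m - (X n + Y n)) < e" by blast
qed

lemma cnorm_mult_diff: "cnorm (x * y - x' * y') \<le> cnorm (x - x') * cnorm y + cnorm x' * cnorm (y - y')"
  for x :: "'a::cstar_seminormed"
proof -
  have "x * y - x' * y' = (x - x') * y + x' * (y - y')" by (simp add: algebra_simps)
  then show ?thesis
    using cnorm_facts(1)[of "(x - x') * y" "x' * (y - y')"] cnorm_facts(3)[of "x - x'" y] cnorm_facts(3)[of x' "y - y'"]
    by simp
qed

lemma cnorm_Cauchy_mult:
  assumes "cnorm_Cauchy X" "cnorm_Cauchy Y"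
  shows "cnorm_Cauchy (\<lambda>n. X n * Y n)"
proof -
  obtain A B where A: "A > 0" "\<And>n. cnorm (X n) \<le> A" and B: "B > 0" "\<And>n. cnorm (Y n) \<le> B"
    using assms cnorm_Cauchy_bounded by metis
  show ?thesis unfolding cnorm_Cauchy_def
  proof (intro allI impI)
    fix e :: real assume e: "e > 0"
    then have "e / (2 * B) > 0" "e / (2 * A) > 0" using A B by auto
    then obtain N M where N: "\<forall>m\<ge>N. \<forall>n\<ge>N. cnorm (X m - X n) < e / (2 * B)"
      and M: "\<forall>m\<ge>M. \<forall>n\<ge>M. cnorm (Y m - Y n) < e / (2 * A)"
      using assms unfolding cnorm_Cauchy_def by meson
    have "cnorm (X m * Y m - X n * Y n) < e" if "m \<ge> max N M" "n \<ge> max N M" for m n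
    proof -
      have 1: "cnorm (X m - X n) < e / (2 * B)" and 2: "cnorm (Y m - Y n) < e / (2 * A)"
        using N M that by auto
      have "cnorm (X m - X n) * cnorm (Y m) \<le> cnorm (X m - X n) * B"
        by (intro mult_left_mono B cnorm_facts(7))
      moreover have "cnorm (X m - X n) * B < e / 2" using 1 B(1) by (simp add: field_simps)
      moreover have "cnorm (X n) * cnorm (Y m - Y n) \<le> A * cnorm (Y m - Y n)"
        by (intro mult_right_mono A cnorm_facts(7))
      moreover have "A * cnorm (Y m - Y n) < e / 2" using 2 A(1) by (simp add: field_simps)
      ultimately show ?thesis using cnorm_mult_diff[of "X m" "Y m" "X n" "Y n"] by linarith
    qed
    then show "\<exists>N. \<forall>m\<ge>N. \<forall>n\<ge>N. cnorm (X m * Y m - X n * Y n) < e" by blast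
  qed
qed

lemma cnorm_Cauchy_uminus: "cnorm_Cauchy X \<Longrightarrow> cnorm_Cauchy (\<lambda>n. - X n)"
  by (erule cnorm_Cauchy_Lipschitz[of _ uminus 1]) (simp add: cnorm_minus_commute)

lemma cnorm_Cauchy_scaleC: "cnorm_Cauchy X \<Longrightarrow> cnorm_Cauchy (\<lambda>n. c *\<^sub>C X n)"
  by (erule cnorm_Cauchy_Lipschitz) (auto simp flip: scaleC_diff_right simp: cnorm_facts(2))

lemma cnorm_Cauchy_star: "cnorm_Cauchy X \<Longrightarrow> cnorm_Cauchy (\<lambda>n. star (X n))"
  by (erule cnorm_Cauchy_Lipschitz[of _ star 1]) (auto simp flip: star_diff simp: cnorm_facts(8))

lemmas cnorm_Cauchy_intros = cnorm_Cauchy_const cnorm_Cauchy_add cnorm_Cauchy_mult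
  cnorm_Cauchy_uminus cnorm_Cauchy_scaleC cnorm_Cauchy_star

lemma completion_rel_I:
  assumes "cnorm_Cauchy X" "cnorm_Cauchy Y" "\<And>n. cnorm (X n - Y n) \<le> r n" "r \<longlonglongrightarrow> 0"
  shows "completion_rel X Y"
  using assms unfolding completion_rel_def
  by (auto intro!: tendsto_sandwich[of "\<lambda>_. 0" "\<lambda>n. cnorm (X n - Y n)" _ r] simp: cnorm_facts(7))

quotient_type (overloaded) 'a completion = "nat \<Rightarrow> 'a::cstar_seminormed" / partial: completion_rel
proof (rule part_equivpI)
  show "\<exists>X. completion_rel X (X :: nat \<Rightarrow> 'a)"
    by (rule exI[of _ "\<lambda>_. 0"]) (simp add: completion_rel_def cnorm_Cauchy_const cnorm_facts(5))
  show "symp (completion_rel :: (nat \<Rightarrow> 'a) \<Rightarrow> _)"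
    by (rule sympI) (simp add: completion_rel_def cnorm_minus_commute)
  show "transp (completion_rel :: (nat \<Rightarrow> 'a) \<Rightarrow> _)"
  proof (rule transpI)
    fix X Y Z :: "nat \<Rightarrow> 'a"
    assume *: "completion_rel X Y" "completion_rel Y Z"
    show "completion_rel X Z"
    proof (rule completion_rel_I)
      show "(\<lambda>n. cnorm (X n - Y n) + cnorm (Y n - Z n)) \<longlonglongrightarrow> 0"
        using * by (auto simp: completion_rel_def intro: tendsto_add_zero)
    qed (use * cnorm_diff_triangle in \<open>auto simp: completion_rel_def\<close>)
  qed
qed

lemma completion_rel_refl: "completion_rel X X \<longleftrightarrow> cnorm_Cauchy X"
  by (simp add: completion_rel_def cnorm_facts(5))

lemma completion_rel_Lipschitz:
  assumes "completion_rel X Y" and L: "\<And>x y. cnorm (f x - f y) \<le> L * cnorm (x - y)"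
  shows "completion_rel (\<lambda>n. f (X n)) (\<lambda>n. f (Y n))"
proof (rule completion_rel_I)
  show "(\<lambda>n. L * cnorm (X n - Y n)) \<longlonglongrightarrow> 0"
    using assms(1) by (intro tendsto_mult_right_zero) (simp add: completion_rel_def)
qed (use assms in \<open>auto simp: completion_rel_def intro: cnorm_Cauchy_Lipschitz\<close>)

lemma completion_rel_add:
  assumes "completion_rel X X'" "completion_rel Y Y'"
  shows "completion_rel (\<lambda>n. X n + Y n) (\<lambda>n. X' n + Y' n)"
proof (rule completion_rel_I)
  show "(\<lambda>n. cnorm (X n - X' n) + cnorm (Y n - Y' n)) \<longlonglongrightarrow> 0"
    using assms by (auto simp: completion_rel_def intro: tendsto_add_zero)
  show "cnorm (X n + Y n - (X' n + Y' n)) \<le> cnorm (X n - X' n) + cnorm (Y n - Y' n)" for n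
    using cnorm_facts(1)[of "X n - X' n" "Y n - Y' n"] by (simp add: algebra_simps)
qed (use assms in \<open>auto simp: completion_rel_def intro: cnorm_Cauchy_add\<close>)

lemma completion_rel_mult:
  assumes "completion_rel X X'" "completion_rel Y Y'"
  shows "completion_rel (\<lambda>n. X n * Y n) (\<lambda>n. X' n * Y' n)"
proof (rule completion_rel_I)
  have C: "cnorm_Cauchy X'" "cnorm_Cauchy Y" and
    0: "(\<lambda>n. cnorm (X n - X' n)) \<longlonglongrightarrow> 0" "(\<lambda>n. cnorm (Y n - Y' n)) \<longlonglongrightarrow> 0"
    using assms by (auto simp: completion_rel_def)
  show "(\<lambda>n. cnorm (X n - X' n) * cnorm (Y n) + cnorm (X' n) * cnorm (Y n - Y' n)) \<longlonglongrightarrow> 0"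
    using tendsto_add[OF tendsto_mult[OF 0(1) cnorm_Cauchy_convergent[OF C(2)]]
        tendsto_mult[OF cnorm_Cauchy_convergent[OF C(1)] 0(2)]] by simp
qed (use assms cnorm_mult_diff in \<open>auto simp: completion_rel_def intro: cnorm_Cauchy_mult\<close>)

instantiation completion :: (cstar_seminormed) star_algebra
begin
lift_definition zero_completion :: "'a completion" is "\<lambda>_. 0"
  by (simp add: completion_rel_refl cnorm_Cauchy_const)
lift_definition one_completion :: "'a completion" is "\<lambda>_. 1"
  by (simp add: completion_rel_refl cnorm_Cauchy_const)
lift_definition plus_completion :: "'a completion \<Rightarrow> 'a completion \<Rightarrow> 'a completion"
  is "\<lambda>X Y n. X n + Y n" by (rule completion_rel_add)
lift_definition uminus_completion :: "'a completion \<Rightarrow> 'a completion" is "\<lambda>X n. - X n"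
  by (rule completion_rel_Lipschitz[of _ _ uminus 1, simplified])
     (simp_all add: cnorm_minus_commute)
lift_definition times_completion :: "'a completion \<Rightarrow> 'a completion \<Rightarrow> 'a completion"
  is "\<lambda>X Y n. X n * Y n" by (rule completion_rel_mult)
lift_definition scaleC_completion :: "complex \<Rightarrow> 'a completion \<Rightarrow> 'a completion"
  is "\<lambda>c X n. c *\<^sub>C X n"
  by (rule completion_rel_Lipschitz) (auto simp flip: scaleC_diff_right simp: cnorm_facts(2))
lift_definition star_completion :: "'a completion \<Rightarrow> 'a completion" is "\<lambda>X n. star (X n)"
  by (rule completion_rel_Lipschitz[of _ _ star 1]) (auto simp flip: star_diff simp: cnorm_facts(8))
definition minus_completion :: "'a completion \<Rightarrow> 'a completion \<Rightarrow> 'a completion" where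
  "minus_completion x y = x + - y"
lemma completion_rel_eqI:
  assumes "cnorm_Cauchy X" "\<And>n. X n = Y n"
  shows "completion_rel X Y"
proof -
  have "X = Y" using assms(2) by blast
  then show ?thesis using assms(1) completion_rel_refl by auto
qed

instance
  by (standard; (simp only: minus_completion_def)?;
     (transfer; rule completion_rel_eqI;
     simp add: algebra_simps scaleC_add_right scaleC_add_left
      scaleC_scaleC scaleC_one mult_scaleC_left mult_scaleC_right star_star star_add star_scaleC
      star_mult completion_rel_refl cnorm_Cauchy_intros)?)

end

lift_definition to_completion :: "'a::cstar_seminormed \<Rightarrow> 'a completion" is "\<lambda>x n. x"
  by (simp add: completion_rel_refl cnorm_Cauchy_const)

lemma to_completion_hom: "unital_star_hom to_completion"
  unfolding unital_star_hom_def
  by (intro conjI allI; transfer; simp add: completion_rel_refl cnorm_Cauchy_const)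

instantiation completion :: (cstar_seminormed) real_normed_algebra
begin
definition scaleR_completion :: "real \<Rightarrow> 'a completion \<Rightarrow> 'a completion" where
  "scaleR_completion r x = complex_of_real r *\<^sub>C x"
lift_definition norm_completion :: "'a completion \<Rightarrow> real" is "\<lambda>X. lim (\<lambda>n. cnorm (X n))"
proof -
  fix X Y :: "nat \<Rightarrow> 'a"
  assume *: "completion_rel X Y"
  then have X: "(\<lambda>n. cnorm (X n)) \<longlonglongrightarrow> lim (\<lambda>n. cnorm (X n))"
    by (auto simp: completion_rel_def intro: cnorm_Cauchy_convergent)
  have "(\<lambda>n. cnorm (X n) - cnorm (Y n)) \<longlonglongrightarrow> 0"
    by (rule Lim_null_comparison[of _ "\<lambda>n. cnorm (X n - Y n)"])
       (use * in \<open>auto simp: completion_rel_def cnorm_abs_diff\<close>)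
  from tendsto_diff[OF X this] have "(\<lambda>n. cnorm (Y n)) \<longlonglongrightarrow> lim (\<lambda>n. cnorm (X n))" by simp
  then show "lim (\<lambda>n. cnorm (X n)) = lim (\<lambda>n. cnorm (Y n))" by (simp add: limI)
qed

definition "dist x y = norm (x - y)" for x y :: "'a completion"
definition "sgn x = complex_of_real (inverse (norm x)) *\<^sub>C x" for x :: "'a completion"
definition uniformity_completion :: "('a completion \<times> 'a completion) filter" where
  "uniformity_completion = (INF e\<in>{0<..}. principal {(x, y). dist x y < e})"
definition open_completion :: "'a completion set \<Rightarrow> bool" where
  "open_completion U \<longleftrightarrow> (\<forall>x\<in>U. \<forall>\<^sub>F (x', y) in uniformity. x' = x \<longrightarrow> y \<in> U)"

lemma norm_to_completion: "norm (to_completion x) = cnorm x" for x :: 'a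
  by transfer simp

lemma norm_abs_completion:
  assumes "cnorm_Cauchy (X :: nat \<Rightarrow> 'a)"
  shows "(\<lambda>n. cnorm (X n)) \<longlonglongrightarrow> norm (abs_completion X)"
  using cnorm_Cauchy_convergent[OF assms] norm_completion.abs_eq[of X] assms
  by (simp add: completion_rel_refl)

lemma completion_cases_abs:
  obtains X where "cnorm_Cauchy X" "(x :: 'a completion) = abs_completion X"
proof -
  have "completion_rel (rep_completion x) (rep_completion x)" "abs_completion (rep_completion x) = x"
    using Quotient_completion by (auto simp: Quotient_def)
  then show ?thesis using that completion_rel_refl by metis
qed

lemma norm_completion_mult: "norm (x * y) \<le> norm x * norm y" for x y :: "'a completion"
proof -
  obtain X Y where X: "cnorm_Cauchy X" "x = abs_completion X"
    and Y: "cnorm_Cauchy Y" "y = abs_completion Y" by (meson completion_cases_abs)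
  have "x * y = abs_completion (\<lambda>n. X n * Y n)"
    using X Y by (simp add: times_completion.abs_eq completion_rel_refl)
  then have "(\<lambda>n. cnorm (X n * Y n)) \<longlonglongrightarrow> norm (x * y)"
    using norm_abs_completion[OF cnorm_Cauchy_mult[OF X(1) Y(1)]] by simp
  then show ?thesis
    by (rule LIMSEQ_le[OF _ tendsto_mult[OF norm_abs_completion[OF X(1)] norm_abs_completion[OF Y(1)]],
          folded X(2) Y(2)])
       (simp add: cnorm_facts(3))
qed

lemma norm_completion_add: "norm (x + y) \<le> norm x + norm y" for x y :: "'a completion"
proof -
  obtain X Y where X: "cnorm_Cauchy X" "x = abs_completion X"
    and Y: "cnorm_Cauchy Y" "y = abs_completion Y" by (meson completion_cases_abs)
  have "x + y = abs_completion (\<lambda>n. X n + Y n)"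
    using X Y by (simp add: plus_completion.abs_eq completion_rel_refl)
  then have "(\<lambda>n. cnorm (X n + Y n)) \<longlonglongrightarrow> norm (x + y)"
    using norm_abs_completion[OF cnorm_Cauchy_add[OF X(1) Y(1)]] by simp
  then show ?thesis
    by (rule LIMSEQ_le[OF _ tendsto_add[OF norm_abs_completion[OF X(1)] norm_abs_completion[OF Y(1)]],
          folded X(2) Y(2)])
       (simp add: cnorm_facts(1))
qed

lemma norm_completion_scaleC: "norm (c *\<^sub>C x) = cmod c * norm x" for x :: "'a completion"
proof -
  obtain X where X: "cnorm_Cauchy X" "x = abs_completion X" by (meson completion_cases_abs)
  have "c *\<^sub>C x = abs_completion (\<lambda>n. c *\<^sub>C X n)"
    using X by (simp add: scaleC_completion.abs_eq completion_rel_refl)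
  then have "(\<lambda>n. cmod c * cnorm (X n)) \<longlonglongrightarrow> norm (c *\<^sub>C x)"
    using norm_abs_completion[OF cnorm_Cauchy_scaleC[OF X(1), of c]] by (simp add: cnorm_facts(2))
  then show ?thesis
    by (rule LIMSEQ_unique[OF _ tendsto_mult_left]) (use X norm_abs_completion in auto)
qed

lemma norm_completion_star_mult: "norm (star x * x) = (norm x)\<^sup>2" for x :: "'a completion"
proof -
  obtain X where X: "cnorm_Cauchy X" "x = abs_completion X" by (meson completion_cases_abs)
  have C: "cnorm_Cauchy (\<lambda>n. star (X n) * X n)" using X by (intro cnorm_Cauchy_intros)
  have "star x * x = abs_completion (\<lambda>n. star (X n) * X n)"
    using X by (simp add: star_completion.abs_eq times_completion.abs_eq completion_rel_refl
        cnorm_Cauchy_star)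
  then have "(\<lambda>n. (cnorm (X n))\<^sup>2) \<longlonglongrightarrow> norm (star x * x)"
    using norm_abs_completion[OF C] by (simp add: cnorm_facts(4))
  then show ?thesis
    by (rule LIMSEQ_unique[OF _ tendsto_power]) (use X norm_abs_completion in auto)
qed

lemma norm_completion_eq_0: "norm x = 0 \<longleftrightarrow> x = 0" for x :: "'a completion"
proof -
  obtain X where X: "cnorm_Cauchy X" "x = abs_completion X" by (meson completion_cases_abs)
  have "x = 0 \<longleftrightarrow> completion_rel X (\<lambda>_. 0)"
    using X Quotient_rel[OF Quotient_completion, of X "\<lambda>_. 0"]
    by (simp add: zero_completion_def completion_rel_refl cnorm_Cauchy_const)
  also have "\<dots> \<longleftrightarrow> (\<lambda>n. cnorm (X n)) \<longlonglongrightarrow> 0"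
    using X by (simp add: completion_rel_def cnorm_Cauchy_const)
  also have "\<dots> \<longleftrightarrow> norm x = 0"
    using norm_abs_completion[OF X(1)] X(2) LIMSEQ_unique by auto
  finally show ?thesis by simp
qed

lemma to_completion_LIMSEQ:
  assumes "cnorm_Cauchy (X :: nat \<Rightarrow> 'a)" "e > 0"
  shows "\<exists>N. \<forall>n\<ge>N. norm (to_completion (X n) - abs_completion X) < e"
proof -
  obtain N where N: "\<forall>m\<ge>N. \<forall>n\<ge>N. cnorm (X m - X n) < e / 2"
    using assms unfolding cnorm_Cauchy_def by (meson half_gt_zero)
  have "norm (to_completion (X n) - abs_completion X) < e" if n: "n \<ge> N" for n
  proof -
    have C: "cnorm_Cauchy (\<lambda>k. X n + - X k)" using assms by (intro cnorm_Cauchy_intros)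
    have "to_completion (X n) - abs_completion X = abs_completion (\<lambda>k. X n + - X k)"
      using assms by (simp add: minus_completion_def to_completion.abs_eq uminus_completion.abs_eq
          plus_completion.abs_eq completion_rel_refl cnorm_Cauchy_intros)
    then have "(\<lambda>k. cnorm (X n - X k)) \<longlonglongrightarrow> norm (to_completion (X n) - abs_completion X)"
      using norm_abs_completion[OF C] by simp
    then have "norm (to_completion (X n) - abs_completion X) \<le> e / 2"
      by (rule LIMSEQ_le_const2) (use N n in \<open>auto intro!: exI[of _ N] less_imp_le\<close>)
    then show ?thesis using assms(2) by simp
  qed
  then show ?thesis by blast
qed

instance
proof
  fix x y z :: "'a completion" and r s :: real and c :: complex
  show "dist x y = norm (x - y)" by (rule dist_completion_def)
  show "sgn x = inverse (norm x) *\<^sub>R x" by (simp add: sgn_completion_def scaleR_completion_def)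
  show "uniformity = (INF e\<in>{0<..}. principal {(x::'a completion, y). dist x y < e})"
    by (rule uniformity_completion_def)
  show "open U = (\<forall>x\<in>U. \<forall>\<^sub>F (x', y) in uniformity. x' = x \<longrightarrow> y \<in> U)" for U :: "'a completion set"
    by (rule open_completion_def)
  show "norm x = 0 \<longleftrightarrow> x = 0" by (rule norm_completion_eq_0)
  show "norm (x + y) \<le> norm x + norm y" by (rule norm_completion_add)
  show "norm (r *\<^sub>R x) = \<bar>r\<bar> * norm x" by (simp add: scaleR_completion_def norm_completion_scaleC)
  show "norm (x * y) \<le> norm x * norm y" by (rule norm_completion_mult)
  show "r *\<^sub>R (x + y) = r *\<^sub>R x + r *\<^sub>R y" "(r + s) *\<^sub>R x = r *\<^sub>R x + s *\<^sub>R x"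
    "r *\<^sub>R s *\<^sub>R x = (r * s) *\<^sub>R x" "1 *\<^sub>R x = x" "r *\<^sub>R x * y = r *\<^sub>R (x * y)"
    "x * r *\<^sub>R y = r *\<^sub>R (x * y)"
    by (simp_all add: scaleR_completion_def scaleC_add_right scaleC_add_left scaleC_scaleC scaleC_one
        mult_scaleC_left mult_scaleC_right)
qed

end

instance completion :: (cstar_seminormed) cstar_algebra
proof
  fix x :: "'a completion" and r :: real and c :: complex
  show "r *\<^sub>R x = complex_of_real r *\<^sub>C x" by (rule scaleR_completion_def)
  show "norm (c *\<^sub>C x) = cmod c * norm x" by (rule norm_completion_scaleC)
  show "norm (star x * x) = (norm x)\<^sup>2" by (rule norm_completion_star_mult)
next
  fix Y :: "nat \<Rightarrow> 'a completion"
  assume Y: "Cauchy Y"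
  have nm: "norm (- x) = norm x" for x :: "'a completion"
    using norm_completion_scaleC[of "- 1" x] by (simp add: scaleC_minus_one)
  have tri: "norm (x - z) \<le> norm (x - y) + norm (y - z)" for x y z :: "'a completion"
    using norm_completion_add[of "x - y" "y - z"] by simp
  have sym: "norm (x - y) = norm (y - x)" for x y :: "'a completion"
    using nm[of "x - y"] by simp
  have "\<exists>x. norm (Y n - to_completion x) < inverse (Suc n)" for n
  proof -
    obtain X where X: "cnorm_Cauchy X" "Y n = abs_completion X" by (meson completion_cases_abs)
    show ?thesis using to_completion_LIMSEQ[OF X(1), of "inverse (Suc n)"] X(2) sym
      by (metis inverse_positive_iff_positive of_nat_0_less_iff zero_less_Suc le_refl)
  qed
  then obtain x where x: "\<And>n. norm (Y n - to_completion (x n)) < inverse (Suc n)" by metis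
  have small: "\<exists>N. \<forall>n\<ge>N. norm (Y n - to_completion (x n)) < e" if "e > 0" for e
  proof -
    obtain N where N: "inverse (Suc N) < e" using reals_Archimedean[OF \<open>e > 0\<close>] by blast
    have "inverse (Suc n) \<le> inverse (Suc N)" if "n \<ge> N" for n
      using that by (simp add: field_simps)
    then show ?thesis using x N by (meson less_le_trans less_trans)
  qed
  have C: "cnorm_Cauchy x" unfolding cnorm_Cauchy_def
  proof (intro allI impI)
    fix e :: real assume "e > 0"
    then have e3: "e / 3 > 0" by simp
    obtain N where N: "\<forall>n\<ge>N. norm (Y n - to_completion (x n)) < e / 3" using small[OF e3] by blast
    obtain M where M: "\<forall>m\<ge>M. \<forall>n\<ge>M. norm (Y m - Y n) < e / 3"
      using Y e3 unfolding Cauchy_def dist_completion_def by blast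
    have "cnorm (x m - x n) < e" if "m \<ge> max N M" "n \<ge> max N M" for m n
    proof -
      have h: "to_completion (a - b) = to_completion a - to_completion b" for a b :: 'a
        using to_completion_hom unfolding unital_star_hom_def
        by (metis diff_add_cancel eq_diff_eq)
      have "cnorm (x m - x n) = norm (to_completion (x m) - to_completion (x n))"
        by (simp flip: norm_to_completion h)
      also have "\<dots> \<le> norm (to_completion (x m) - Y m) + (norm (Y m - Y n) + norm (Y n - to_completion (x n)))"
        using tri[of "to_completion (x m)" "to_completion (x n)" "Y m"]
          tri[of "Y m" "to_completion (x n)" "Y n"] by linarith
      also have "\<dots> < e"
      proof -
        have "norm (to_completion (x m) - Y m) < e / 3" "norm (Y n - to_completion (x n)) < e / 3"
          "norm (Y m - Y n) < e / 3"
          using N M that sym by auto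
        then show ?thesis by linarith
      qed
      finally show ?thesis .
    qed
    then show "\<exists>N. \<forall>m\<ge>N. \<forall>n\<ge>N. cnorm (x m - x n) < e" by blast
  qed
  have "\<exists>N. \<forall>n\<ge>N. norm (Y n - abs_completion x) < e" if e: "e > 0" for e
  proof -
    have e2: "e / 2 > 0" using e by simp
    obtain N where N: "\<forall>n\<ge>N. norm (Y n - to_completion (x n)) < e / 2" using small[OF e2] by blast
    obtain M where M: "\<forall>n\<ge>M. norm (to_completion (x n) - abs_completion x) < e / 2"
      using to_completion_LIMSEQ[OF C e2] by blast
    have "norm (Y n - abs_completion x) < e" if "n \<ge> max N M" for n
    proof -
      have "norm (Y n - to_completion (x n)) < e / 2"
        "norm (to_completion (x n) - abs_completion x) < e / 2" using N M that by auto
      then show ?thesis using tri[of "Y n" "abs_completion x" "to_completion (x n)"] by linarith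
    qed
    then show ?thesis by blast
  qed
  then have "Y \<longlonglongrightarrow> abs_completion x"
    unfolding lim_sequentially dist_completion_def by blast
  then show "convergent Y" by (auto simp: convergent_def)
qed


lemma norm_star: "norm (star x) = norm x" for x :: "'a::cstar_algebra"
  by (rule cstar_seminorm_star[OF cstar_seminorm_norm])

lemma star_scaleR: "star (r *\<^sub>R x) = r *\<^sub>R star x" for x :: "'a::cstar_algebra"
  by (simp add: scaleR_scaleC star_scaleC)

lemma bounded_linear_star: "bounded_linear (star :: 'a::cstar_algebra \<Rightarrow> 'a)"
  by (rule bounded_linear_intro[of _ 1]) (simp_all add: star_add star_scaleR norm_star)

lemma gbinomial_half_bound: "\<bar>(1 / 2 :: real) gchoose n\<bar> \<le> 1"
proof (induction n)
  case (Suc n)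
  have "real (Suc n) * ((1 / 2) gchoose Suc n) = (1 / 2 - real n) * ((1 / 2) gchoose n)"
    using gbinomial_mult_1[of "1 / 2 :: real" n] by (simp add: algebra_simps)
  then have "real (Suc n) * \<bar>(1 / 2) gchoose Suc n\<bar> = \<bar>1 / 2 - real n\<bar> * \<bar>(1 / 2) gchoose n\<bar>"
    by (metis abs_mult abs_of_nat)
  also have "\<dots> \<le> real (Suc n) * 1"
    using Suc by (intro mult_mono) auto
  finally show ?case using mult_le_cancel_left_pos[of "real (Suc n)"] by simp
qed simp

lemma sqrt_one_minus_square:
  fixes h :: "'a::cstar_algebra"
  assumes "star h = h" "norm h < 1"
  shows "\<exists>k. star k = k \<and> h * k = k * h \<and> k * k = 1 - h * h"
proof -
  define y where "y = h * h"
  define b where "b n = (- 1) ^ n * ((1 / 2 :: real) gchoose n)" for n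
  define k where "k = suminf (\<lambda>n. b n *\<^sub>R y ^ n)"
  have ny: "norm y < 1"
  proof -
    have "norm y \<le> norm h * norm h" unfolding y_def by (rule norm_mult_ineq)
    also have "\<dots> \<le> 1 * norm h" using assms(2) by (intro mult_right_mono) auto
    finally show ?thesis using assms(2) by simp
  qed
  have pow: "norm (y ^ n) \<le> (norm (1::'a) + 1) * norm y ^ n" for n
  proof (induction n)
    case (Suc n)
    have "norm (y ^ Suc n) \<le> norm y * norm (y ^ n)" by (simp add: norm_mult_ineq)
    also have "\<dots> \<le> norm y * ((norm (1::'a) + 1) * norm y ^ n)"
      by (intro mult_left_mono Suc) auto
    finally show ?case by (simp add: algebra_simps)
  qed simp
  have sum: "summable (\<lambda>n. norm (b n *\<^sub>R y ^ n))"
  proof (rule summable_comparison_test')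
    show "summable (\<lambda>n. (norm (1::'a) + 1) * norm y ^ n)"
      using ny by (intro summable_mult summable_geometric) auto
    show "norm (norm (b n *\<^sub>R y ^ n)) \<le> (norm (1::'a) + 1) * norm y ^ n" if "n \<ge> 0" for n
    proof -
      have "\<bar>b n\<bar> \<le> 1" using gbinomial_half_bound[of n] by (simp add: b_def abs_mult)
      then have "\<bar>b n\<bar> * norm (y ^ n) \<le> 1 * norm (y ^ n)" by (rule mult_right_mono) auto
      then show ?thesis using pow[of n] by simp
    qed
  qed
  then have sum': "summable (\<lambda>n. b n *\<^sub>R y ^ n)" by (rule summable_norm_cancel)
  have sy: "star y = y" using assms(1) by (simp add: y_def star_mult)
  have syn: "star (y ^ n) = y ^ n" for n
    by (induction n) (simp_all add: star_one star_mult sy power_commutes)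
  have "star k = k"
    unfolding k_def bounded_linear.suminf[OF bounded_linear_star sum']
    by (simp add: star_scaleR syn)
  moreover have "h * k = k * h"
  proof -
    have c: "h * y ^ n = y ^ n * h" for n
      by (rule power_commuting_commutes[symmetric]) (simp add: y_def mult.assoc)
    show ?thesis
      unfolding k_def suminf_mult2[OF sum'] bounded_linear.suminf[OF bounded_linear_mult_right sum']
      by (simp add: c)
  qed
  moreover have "k * k = 1 - y"
  proof -
    have "k * k = suminf (\<lambda>n. \<Sum>i\<le>n. (b i *\<^sub>R y ^ i) * (b (n - i) *\<^sub>R y ^ (n - i)))"
      unfolding k_def by (rule Cauchy_product[OF sum sum])
    also have "\<dots> = suminf (\<lambda>n. ((- 1) ^ n * ((1::real) gchoose n)) *\<^sub>R y ^ n)"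
    proof (rule arg_cong[of _ _ suminf], rule ext)
      fix n
      have "(\<Sum>i\<le>n. (b i *\<^sub>R y ^ i) * (b (n - i) *\<^sub>R y ^ (n - i)))
          = (\<Sum>i\<le>n. (b i * b (n - i)) *\<^sub>R y ^ n)"
        by (rule sum.cong) (simp_all flip: power_add)
      also have "\<dots> = (\<Sum>i\<le>n. b i * b (n - i)) *\<^sub>R y ^ n"
        by (simp add: scaleR_left.sum)
      also have "(\<Sum>i\<le>n. b i * b (n - i))
          = (- 1) ^ n * (\<Sum>i\<le>n. ((1 / 2 :: real) gchoose i) * ((1 / 2) gchoose (n - i)))"
        unfolding sum_distrib_left
      proof (rule sum.cong)
        fix i assume "i \<in> {..n}"
        then have "(- 1 :: real) ^ i * (- 1) ^ (n - i) = (- 1) ^ n" by (simp flip: power_add)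
        then show "b i * b (n - i) = (- 1) ^ n * (((1 / 2) gchoose i) * ((1 / 2) gchoose (n - i)))"
          unfolding b_def by (metis (no_types, lifting) mult.assoc mult.left_commute)
      qed simp
      also have "(\<Sum>i\<le>n. ((1 / 2 :: real) gchoose i) * ((1 / 2) gchoose (n - i))) = 1 gchoose n"
        using gbinomial_Vandermonde[of "1/2 :: real" "1/2" n] by (simp add: atMost_atLeast0)
      finally show "(\<Sum>i\<le>n. (b i *\<^sub>R y ^ i) * (b (n - i) *\<^sub>R y ^ (n - i)))
          = ((- 1) ^ n * ((1::real) gchoose n)) *\<^sub>R y ^ n" .
    qed
    also have "\<dots> = (\<Sum>n\<in>{0, 1}. ((- 1) ^ n * ((1::real) gchoose n)) *\<^sub>R y ^ n)"
    proof (rule suminf_finite)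
      fix n :: nat assume "n \<notin> {0, 1}"
      then have "(1::nat) choose n = 0" by (simp add: binomial_eq_0)
      then have "(1::real) gchoose n = 0" by (metis binomial_gbinomial of_nat_0 of_nat_1)
      then show "((- 1) ^ n * ((1::real) gchoose n)) *\<^sub>R y ^ n = 0" by simp
    qed simp
    finally show ?thesis by simp
  qed
  ultimately show ?thesis unfolding y_def by blast
qed

lemma cstar_seminorm_le_norm:
  fixes x :: "'a::cstar_algebra"
  assumes p: "cstar_seminorm p"
  shows "p x \<le> norm x"
proof -
  have 1: "p h \<le> 1" if h: "star h = h" "norm h < 1" for h
  proof -
    obtain k where k: "star k = k" "h * k = k * h" "k * k = 1 - h * h"
      using sqrt_one_minus_square[OF h] by blast
    define u where "u = h + \<i> *\<^sub>C k"
    have su: "star u = h - \<i> *\<^sub>C k"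
      using scaleC_scaleC[of "- 1" \<i> k]
      by (simp add: u_def star_add star_scaleC h(1) k(1) scaleC_minus_one)
    have "star u * u = 1"
      unfolding su unfolding u_def
      by (simp add: k scaleC_scaleC scaleC_minus_one mult_scaleC_left mult_scaleC_right
          scaleC_add_right scaleC_diff_right scaleC_uminus algebra_simps)
    then have "(p u)\<^sup>2 \<le> 1"
      using cstar_seminorm_star_mult[OF p, of u] cstar_seminorm_one[OF p] by simp
    then have pu: "p u \<le> 1" by (simp add: power_le_one_iff cstar_seminorm_nonneg[OF p])
    have "u + star u = 2 *\<^sub>C h"
      using scaleC_add_left[of 1 1 h] unfolding su unfolding u_def by (simp add: scaleC_one)
    then have "2 * p h = p (u + star u)" using cstar_seminorm_scaleC[OF p, of 2 h] by simp
    also have "\<dots> \<le> p u + p (star u)" by (rule cstar_seminorm_add[OF p])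
    finally show ?thesis using pu cstar_seminorm_star[OF p, of u] by simp
  qed
  have 2: "p h \<le> norm h" if h: "star h = h" for h
  proof (rule field_le_epsilon)
    fix e :: real assume "e > 0"
    define r where "r = norm h + e"
    have r: "r > 0" "norm h < r" using \<open>e > 0\<close> by (auto simp: r_def add_nonneg_pos)
    have "p (complex_of_real (1 / r) *\<^sub>C h) \<le> 1"
      using r by (intro 1) (simp_all add: star_scaleC h norm_scaleC norm_divide)
    then show "p h \<le> norm h + e"
      unfolding cstar_seminorm_scaleC[OF p] norm_of_real using r by (simp add: field_simps r_def)
  qed
  have "(p x)\<^sup>2 \<le> (norm x)\<^sup>2"
    using 2[of "star x * x"] cstar_seminorm_star_mult[OF p, of x]
    by (simp add: star_mult star_star norm_star_mult)
  then show ?thesis by (simp add: power2_le_iff_abs_le)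
qed

definition star_algebra_bounded :: "'a::star_algebra \<Rightarrow> bool" where
  "star_algebra_bounded x \<longleftrightarrow> (\<exists>M. \<forall>p. cstar_seminorm p \<longrightarrow> p x \<le> M)"

lemma star_algebra_bounded_subalgebra:
  assumes "\<And>x. x \<in> S \<Longrightarrow> star_algebra_bounded x" "x \<in> star_subalgebra S"
  shows "star_algebra_bounded x"
  using assms(2)
proof induction
  case (gen x)
  then show ?case using assms(1) by blast
next
  case one
  then show ?case using cstar_seminorm_one by (auto simp: star_algebra_bounded_def)
next
  case (add x y)
  then obtain M N where "\<And>p. cstar_seminorm p \<Longrightarrow> p x \<le> M" "\<And>p. cstar_seminorm p \<Longrightarrow> p y \<le> N"
    by (auto simp: star_algebra_bounded_def)
  then have "p (x + y) \<le> M + N" if "cstar_seminorm p" for p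
    using cstar_seminorm_add[OF that, of x y] that by (meson add_mono order_trans)
  then show ?case by (auto simp: star_algebra_bounded_def)
next
  case (scale x c)
  then obtain M where "\<And>p. cstar_seminorm p \<Longrightarrow> p x \<le> M" by (auto simp: star_algebra_bounded_def)
  then have "p (c *\<^sub>C x) \<le> cmod c * M" if "cstar_seminorm p" for p
    using cstar_seminorm_scaleC[OF that, of c x] that by (simp add: mult_left_mono)
  then show ?case by (auto simp: star_algebra_bounded_def)
next
  case (mult x y)
  then obtain M N where *: "\<And>p. cstar_seminorm p \<Longrightarrow> p x \<le> M" "\<And>p. cstar_seminorm p \<Longrightarrow> p y \<le> N"
    by (auto simp: star_algebra_bounded_def)
  have "p (x * y) \<le> M * N" if "cstar_seminorm p" for p
  proof -
    have "p (x * y) \<le> p x * p y" by (rule cstar_seminorm_mult[OF that])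
    also have "\<dots> \<le> M * N"
      using *(1)[OF that] *(2)[OF that] cstar_seminorm_nonneg[OF that, of x] cstar_seminorm_nonneg[OF that, of y]
      by (intro mult_mono) linarith+
    finally show ?thesis .
  qed
  then show ?case by (auto simp: star_algebra_bounded_def)
next
  case (star x)
  then show ?case by (auto simp: star_algebra_bounded_def cstar_seminorm_star)
qed

lemma abs_pol_su_hom:
  "abs_pol_su (x + y) = abs_pol_su x + abs_pol_su y"
  "abs_pol_su (x * y) = abs_pol_su x * abs_pol_su y"
  "abs_pol_su (c *\<^sub>C x) = c *\<^sub>C abs_pol_su x"
  "abs_pol_su (star x) = star (abs_pol_su x)"
  "abs_pol_su 0 = 0" "abs_pol_su 1 = 1"
  by (simp_all add: plus_pol_su.abs_eq times_pol_su.abs_eq scaleC_pol_su.abs_eq star_pol_su.abs_eq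
      zero_pol_su_def one_pol_su_def)

lemma pol_su_generated: "x \<in> star_subalgebra {su_alpha, su_gamma}"
proof -
  let ?A = "star_subalgebra {su_alpha, su_gamma}"
  have gen: "abs_pol_su (free_gen g) \<in> ?A" for g
    by (cases g) (auto simp: su_alpha_def su_gamma_def intro: star_subalgebra.gen)
  have letter: "abs_pol_su (Poly_Mapping.single (Word [(g, s)]) 1) \<in> ?A" for g s
  proof (cases s)
    case True
    have "star (free_gen g) = Poly_Mapping.single (Word [(g, s)]) 1"
      using True by (simp add: free_gen_def star_single inv_op_word_def star_complex_def)
    then show ?thesis using star_subalgebra.star[OF gen[of g]] by (simp flip: abs_pol_su_hom)
  next
    case False
    then show ?thesis using gen[of g] by (simp add: free_gen_def)
  qed
  have word: "abs_pol_su (Poly_Mapping.single (Word w) 1) \<in> ?A" for w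
  proof (induction w)
    case Nil
    show ?case
      using star_subalgebra.one by (simp flip: zero_word_def add: abs_pol_su_hom)
  next
    case (Cons l w)
    obtain g s where l: "l = (g, s)" by force
    have "Poly_Mapping.single (Word (l # w)) (1::complex)
        = Poly_Mapping.single (Word [(g, s)]) 1 * Poly_Mapping.single (Word w) 1"
      by (simp add: mult_single plus_word_def l)
    then show ?case using star_subalgebra.mult[OF letter[of g s] Cons] by (simp add: abs_pol_su_hom)
  qed
  have "abs_pol_su p \<in> ?A" for p
  proof (induction p rule: poly_mapping_add_induct)
    case zero
    then show ?case using star_subalgebra.scale[OF star_subalgebra.one, of 0]
      by (simp add: abs_pol_su_hom scaleC_zero_left)
  next
    case (single m c)
    have "Poly_Mapping.single m c = c *\<^sub>C Poly_Mapping.single m 1"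
      by (simp add: scaleC_single scaleC_complex_def)
    then show ?case using star_subalgebra.scale[OF word[of "letters m"], of c]
      by (simp add: abs_pol_su_hom)
  next
    case (add p q)
    then show ?case by (simp add: abs_pol_su_hom star_subalgebra.add)
  qed
  from this[of "rep_pol_su x"] show ?thesis by (simp only: Quotient3_abs_rep[OF Quotient3_pol_su])
qed

lemma pol_su_bounded: "star_algebra_bounded (x :: pol_su)"
proof (rule star_algebra_bounded_subalgebra[OF _ pol_su_generated])
  fix y assume "y \<in> {su_alpha, su_gamma}"
  moreover have a: "p su_alpha \<le> 1" if p: "cstar_seminorm p" for p
  proof -
    have "(p (star su_alpha))\<^sup>2 = p 1"
      using cstar_seminorm_star_mult[OF p, of "star su_alpha"] pol_su_relations(5)
      by (simp add: star_star)
    then show ?thesis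
      using cstar_seminorm_one[OF p] power2_le_imp_le[of "p su_alpha" 1]
      by (simp add: cstar_seminorm_star[OF p])
  qed
  moreover have "p su_gamma \<le> 2" if p: "cstar_seminorm p" for p
  proof -
    have "star su_gamma * su_gamma = 1 - star su_alpha * su_alpha"
      using pol_su_relations(4) by (simp add: eq_diff_eq add.commute)
    then have "(p su_gamma)\<^sup>2 \<le> p 1 + (p su_alpha)\<^sup>2"
      using cstar_seminorm_diff[OF p, of 1 "star su_alpha * su_alpha"]
      by (metis cstar_seminorm_star_mult[OF p])
    also have "\<dots> \<le> 1 + 1\<^sup>2"
      using cstar_seminorm_one[OF p] a[OF p] cstar_seminorm_nonneg[OF p, of su_alpha]
      by (intro add_mono power_mono)
    finally have "(p su_gamma)\<^sup>2 \<le> 2\<^sup>2" by simp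
    then show ?thesis by (rule power2_le_imp_le) simp
  qed
  ultimately show "star_algebra_bounded y" unfolding star_algebra_bounded_def by blast
qed

text \<open>
  The completion with respect to the greatest \<open>C\<^sup>*\<close>-seminorm is the universal enveloping
  \<open>C\<^sup>*\<close>-algebra.
\<close>

instantiation pol_su :: cstar_seminormed
begin
definition cnorm_pol_su :: "pol_su \<Rightarrow> real" where
  "cnorm_pol_su x = (SUP p\<in>{p. cstar_seminorm p}. p x)"
instance
proof
  have "cstar_seminorm (\<lambda>x :: pol_su. SUP p\<in>{p. cstar_seminorm p}. p x)"
    by (rule cstar_seminorm_SUP)
       (use pol_su_bounded cstar_seminorm_zero_map in \<open>auto simp: star_algebra_bounded_def\<close>)
  then show "cstar_seminorm (cnorm :: pol_su \<Rightarrow> real)"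
    by (simp add: cnorm_pol_su_def[abs_def])
qed
end

lemma pure_tensor_simps:
  fixes a a' :: "'a::star_algebra" and b b' :: "'b::star_algebra"
  shows
  "pure_tensor (a + a') b = pure_tensor a b + pure_tensor a' b"
  "pure_tensor a (b + b') = pure_tensor a b + pure_tensor a b'"
  "pure_tensor (c *\<^sub>C a) b = c *\<^sub>C pure_tensor a b"
  "pure_tensor a (c *\<^sub>C b) = c *\<^sub>C pure_tensor a b"
  "pure_tensor a b * pure_tensor a' b' = pure_tensor (a * a') (b * b')"
  "star (pure_tensor a b) = pure_tensor (star a) (star b)"
  "pure_tensor 1 1 = (1 :: ('a, 'b) alg_tensor)"
proof -
  have r: "x - y \<in> star_ideal tensor_relators" if "x - y \<in> tensor_relators"
    for x y :: "('a, 'b) elem_tensor \<Rightarrow>\<^sub>0 complex"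
    using that by (rule star_ideal.gen)
  show "pure_tensor (a + a') b = pure_tensor a b + pure_tensor a' b"
    "pure_tensor a (b + b') = pure_tensor a b + pure_tensor a b'"
    "pure_tensor (c *\<^sub>C a) b = c *\<^sub>C pure_tensor a b"
    "pure_tensor a (c *\<^sub>C b) = c *\<^sub>C pure_tensor a b"
    by (transfer, rule r, unfold tensor_relators_def Let_def diff_diff_add[symmetric], blast)+
  show "pure_tensor a b * pure_tensor a' b' = pure_tensor (a * a') (b * b')"
    by transfer (simp add: mult_single plus_elem_tensor_def star_ideal.zero)
  show "star (pure_tensor a b) = pure_tensor (star a) (star b)"
    by transfer (simp add: star_single inv_op_elem_tensor_def star_complex_def star_ideal.zero)
  show "pure_tensor 1 1 = (1 :: ('a, 'b) alg_tensor)"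
    by transfer (simp flip: zero_elem_tensor_def add: star_ideal.zero)
qed

lemma alg_tensor_generated: "x \<in> star_subalgebra {pure_tensor a b |a b. True}"
proof -
  let ?A = "star_subalgebra {pure_tensor a b |a b. True} :: ('a, 'b) alg_tensor set"
  have "abs_alg_tensor p \<in> ?A" for p
  proof (induction p rule: poly_mapping_add_induct)
    case zero
    then show ?case using star_subalgebra.scale[OF star_subalgebra.one, of 0]
      by (simp add: scaleC_zero_left flip: zero_alg_tensor_def)
  next
    case (single m c)
    have "Poly_Mapping.single m c = c *\<^sub>C Poly_Mapping.single (Elem_tensor (tfst m) (tsnd m)) 1"
      by (simp add: scaleC_single scaleC_complex_def)
    then have "abs_alg_tensor (Poly_Mapping.single m c) = c *\<^sub>C pure_tensor (tfst m) (tsnd m)"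
      by (simp add: pure_tensor.abs_eq scaleC_alg_tensor.abs_eq)
    moreover have "pure_tensor (tfst m) (tsnd m) \<in> ?A" by (intro star_subalgebra.gen) blast
    ultimately show ?case using star_subalgebra.scale[of "pure_tensor (tfst m) (tsnd m)"] by simp
  next
    case (add p q)
    then show ?case using star_subalgebra.add[OF add] by (simp add: plus_alg_tensor.abs_eq)
  qed
  from this[of "rep_alg_tensor x"] show ?thesis by (simp only: Quotient3_abs_rep[OF Quotient3_alg_tensor])
qed

lemma alg_tensor_bounded: "star_algebra_bounded (x :: ('a::cstar_algebra, 'b::cstar_algebra) alg_tensor)"
proof (rule star_algebra_bounded_subalgebra[OF _ alg_tensor_generated])
  fix t :: "('a, 'b) alg_tensor" assume "t \<in> {pure_tensor a b |a b. True}"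
  then obtain a b where t: "t = pure_tensor a b" by blast
  have "p t \<le> norm a * norm b" if p: "cstar_seminorm p" for p
  proof -
    have 1: "cstar_seminorm (\<lambda>a :: 'a. p (pure_tensor a 1))"
      by (rule cstar_seminorm_comp[OF p, of "\<lambda>a. pure_tensor a 1"])
         (simp add: unital_star_hom_def pure_tensor_simps star_one)
    have 2: "cstar_seminorm (\<lambda>b :: 'b. p (pure_tensor 1 b))"
      by (rule cstar_seminorm_comp[OF p, of "pure_tensor 1"])
         (simp add: unital_star_hom_def pure_tensor_simps star_one)
    have "p t \<le> p (pure_tensor a 1) * p (pure_tensor 1 b)"
      using cstar_seminorm_mult[OF p, of "pure_tensor a 1" "pure_tensor 1 b"]
      by (simp add: pure_tensor_simps t)
    also have "\<dots> \<le> norm a * norm b"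
      by (intro mult_mono cstar_seminorm_le_norm[OF 1] cstar_seminorm_le_norm[OF 2]
          cstar_seminorm_nonneg[OF p]) simp
    finally show ?thesis .
  qed
  then show "star_algebra_bounded t" by (auto simp: star_algebra_bounded_def)
qed

definition clinear_on :: "'a::star_algebra set \<Rightarrow> ('a \<Rightarrow> complex) \<Rightarrow> bool" where
  "clinear_on B f \<longleftrightarrow> (\<forall>x\<in>B. \<forall>y\<in>B. f (x + y) = f x + f y) \<and> (\<forall>c. \<forall>x\<in>B. f (c *\<^sub>C x) = c * f x)"

definition state_on :: "'a::cstar_algebra set \<Rightarrow> ('a \<Rightarrow> complex) \<Rightarrow> bool" where
  "state_on B f \<longleftrightarrow> clinear_on B f \<and> (\<forall>x\<in>B. f (star x * x) \<in> \<real>\<^sub>\<ge>\<^sub>0) \<and> f 1 = 1"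

text \<open>
  The operator seminorm of the GNS representation of the positive functional \<open>w\<close>: the supremum of
  the norms of \<open>x\<close> applied to the vectors of norm at most one coming from algebra elements \<open>y\<close>.
\<close>

definition gns_seminorm :: "('a::star_algebra \<Rightarrow> complex) \<Rightarrow> 'a \<Rightarrow> real" where
  "gns_seminorm w x =
    (SUP y\<in>{y. Re (w (star y * y)) \<le> 1}. sqrt (Re (w (star (x * y) * (x * y)))))"

definition product_state :: "(('a::cstar_algebra, 'b::cstar_algebra) alg_tensor \<Rightarrow> complex) \<Rightarrow> bool" where
  "product_state w \<longleftrightarrow> clinear_on UNIV w \<and>
    (\<exists>f g. state_on UNIV f \<and> state_on UNIV g \<and> (\<forall>a b. w (pure_tensor a b) = f a * g b))"

text \<open>
  The spatial (minimal) tensor norm: the supremum of the operator norms in the representations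
  \<open>\<pi>\<^sub>f \<otimes> \<pi>\<^sub>g\<close>, where \<open>f\<close> and \<open>g\<close> range over all states; \<open>\<pi>\<^sub>f \<otimes> \<pi>\<^sub>g\<close> is the GNS
  representation of the product state. A GNS seminorm of a product state always is a
  \<open>C\<^sup>*\<close>-seminorm; that this is required explicitly, and that the zero seminorm is added, does not
  change the supremum and makes the instance proof immediate.
\<close>

instantiation alg_tensor :: (cstar_algebra, cstar_algebra) cstar_seminormed
begin
definition cnorm_alg_tensor :: "('a, 'b) alg_tensor \<Rightarrow> real" where
  "cnorm_alg_tensor x = (SUP p\<in>insert (\<lambda>_. 0) {p. cstar_seminorm p \<and> (\<exists>w. product_state w \<and> p = gns_seminorm w)}. p x)"
instance
proof
  have "cstar_seminorm (\<lambda>x :: ('a, 'b) alg_tensor. SUP p\<in>insert (\<lambda>_. 0)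
      {p. cstar_seminorm p \<and> (\<exists>w. product_state w \<and> p = gns_seminorm w)}. p x)"
  proof (rule cstar_seminorm_SUP)
    fix x :: "('a, 'b) alg_tensor"
    obtain M where "\<And>p. cstar_seminorm p \<Longrightarrow> p x \<le> M"
      using alg_tensor_bounded unfolding star_algebra_bounded_def by blast
    then show "\<exists>M. \<forall>p\<in>insert (\<lambda>_. 0) {p. cstar_seminorm p \<and> (\<exists>w. product_state w \<and> p = gns_seminorm w)}.
        p x \<le> M"
      using cstar_seminorm_zero_map by (intro exI[of _ M]) auto
  qed (use cstar_seminorm_zero_map in auto)
  then show "cstar_seminorm (cnorm :: ('a, 'b) alg_tensor \<Rightarrow> real)"
    by (simp add: cnorm_alg_tensor_def[abs_def])
qed
end

type_synonym ('a, 'b) cstar_tensor = "('a, 'b) alg_tensor completion"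

definition tensor :: "'a::cstar_algebra \<Rightarrow> 'b::cstar_algebra \<Rightarrow> ('a, 'b) cstar_tensor"  (infixr \<open>\<otimes>\<close> 70)
  where "a \<otimes> b = to_completion (pure_tensor a b)"

text \<open>
  For a unital \<open>C\<^sup>*\<close>-subalgebra \<open>B\<close> of \<open>A\<close>, the spatial tensor product \<open>B \<otimes> B\<close> is the closed subalgebra of
  \<open>A \<otimes> A\<close> generated by the elementary tensors of elements of \<open>B\<close>. The real span suffices, since
  scalars can be absorbed into the first factor.
\<close>

definition tensor_square :: "'a::cstar_algebra set \<Rightarrow> ('a, 'a) cstar_tensor set" where
  "tensor_square B = closure (span {a \<otimes> b |a b. a \<in> B \<and> b \<in> B})"

text \<open>
  \<open>F\<close> is the functional \<open>f \<otimes> f\<close> on \<open>B \<otimes> B\<close>: the continuous linear extension of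
  \<open>a \<otimes> b \<mapsto> f a * f b\<close>, which is unique and exists for every state \<open>f\<close>. The comultiplication of the
  \<open>C\<^sup>*\<close>-bialgebra \<open>B\<close> is the restriction of \<open>D\<close> to \<open>B\<close>. Only the values of \<open>f\<close> on \<open>B\<close> matter.
\<close>

definition idempotent_state ::
    "'a::cstar_algebra set \<Rightarrow> ('a \<Rightarrow> ('a, 'a) cstar_tensor) \<Rightarrow> ('a \<Rightarrow> complex) \<Rightarrow> bool" where
  "idempotent_state B D f \<longleftrightarrow> state_on B f \<and>
    (\<exists>F. clinear_on (tensor_square B) F \<and> continuous_on (tensor_square B) F \<and>
      (\<forall>a\<in>B. \<forall>b\<in>B. F (a \<otimes> b) = f a * f b) \<and> (\<forall>x\<in>B. F (D x) = f x))"

type_synonym c_su = "pol_su completion"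

definition c_alpha :: c_su where "c_alpha = to_completion su_alpha"
definition c_gamma :: c_su where "c_gamma = to_completion su_gamma"


lemma unital_star_hom_norm:
  fixes f :: "'a::cstar_algebra \<Rightarrow> 'b::cstar_algebra"
  assumes "unital_star_hom f"
  shows "norm (f x) \<le> norm x"
proof -
  have "cstar_seminorm (\<lambda>x. norm (f x))"
    by (rule cstar_seminorm_comp[OF cstar_seminorm_norm assms])
  then show ?thesis by (rule cstar_seminorm_le_norm)
qed

lemma unital_star_hom_continuous:
  fixes f :: "'a::cstar_algebra \<Rightarrow> 'b::cstar_algebra"
  assumes "unital_star_hom f"
  shows "continuous_on A f"
proof -
  have "1-lipschitz_on A f"
    by (rule lipschitz_onI)
       (use unital_star_hom_norm[OF assms] in \<open>auto simp: dist_norm simp flip: unital_star_homD[OF assms]\<close>)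
  then show ?thesis by (rule lipschitz_on_continuous_on)
qed

lemma closure_range_to_completion: "closure (range to_completion) = (UNIV :: 'a::cstar_seminormed completion set)"
proof -
  have "x \<in> closure (range to_completion)" for x :: "'a completion"
  proof -
    obtain X where X: "cnorm_Cauchy X" "x = abs_completion X" by (meson completion_cases_abs)
    have "\<exists>y\<in>range to_completion. dist y x < e" if "e > 0" for e
      using to_completion_LIMSEQ[OF X(1) that] X(2) by (auto simp: dist_norm)
    then show ?thesis unfolding closure_approachable by blast
  qed
  then show ?thesis by blast
qed

lemma completion_hom_unique:
  fixes f g :: "'a::cstar_seminormed completion \<Rightarrow> 'b::cstar_algebra"
  assumes "unital_star_hom f" "unital_star_hom g" "\<And>x. f (to_completion x) = g (to_completion x)"
  shows "f = g"
proof -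
  have "closed {x. f x = g x}"
    using unital_star_hom_continuous[OF assms(1), of UNIV] unital_star_hom_continuous[OF assms(2), of UNIV]
    by (rule closed_Collect_eq)
  moreover have "range to_completion \<subseteq> {x. f x = g x}" using assms(3) by blast
  ultimately have "closure (range to_completion) \<subseteq> {x. f x = g x}" by (simp add: closure_minimal)
  then show ?thesis unfolding closure_range_to_completion by auto
qed

lemma completion_hom_exists:
  fixes h :: "'a::cstar_seminormed \<Rightarrow> 'b::cstar_algebra"
  assumes h: "unital_star_hom h" and le: "\<And>x. norm (h x) \<le> cnorm x"
  shows "\<exists>f. unital_star_hom f \<and> (\<forall>x. f (to_completion x) = h x)"
proof -
  define f where "f x = lim (\<lambda>n. h (rep_completion x n))" for x
  have conv: "(\<lambda>n. h (X n)) \<longlonglongrightarrow> f (abs_completion X)" if X: "cnorm_Cauchy X" for X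
  proof -
    let ?R = "rep_completion (abs_completion X)"
    have rel: "completion_rel ?R X"
      using Quotient_rep_abs[OF Quotient_completion] X by (simp add: completion_rel_refl)
    then have R: "cnorm_Cauchy ?R" "(\<lambda>n. cnorm (?R n - X n)) \<longlonglongrightarrow> 0"
      by (auto simp: completion_rel_def)
    have "Cauchy (\<lambda>n. h (?R n))"
    proof (rule CauchyI)
      fix e :: real assume "e > 0"
      then show "\<exists>M. \<forall>m\<ge>M. \<forall>n\<ge>M. norm (h (?R m) - h (?R n)) < e"
        using R(1) le unfolding cnorm_Cauchy_def
        by (metis unital_star_homD(8)[OF h] order.strict_trans1)
    qed
    then have 1: "(\<lambda>n. h (?R n)) \<longlonglongrightarrow> f (abs_completion X)"
      unfolding f_def by (simp add: Cauchy_convergent_iff convergent_LIMSEQ_iff)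
    have "(\<lambda>n. h (?R n) - h (X n)) \<longlonglongrightarrow> 0"
      by (rule Lim_null_comparison[OF _ R(2)]) (use le in \<open>auto simp flip: unital_star_homD(8)[OF h]\<close>)
    from tendsto_diff[OF 1 this] show ?thesis by simp
  qed
  have lim: "f (abs_completion X) = l" if "cnorm_Cauchy X" "(\<lambda>n. h (X n)) \<longlonglongrightarrow> l" for X l
    using conv[OF that(1)] that(2) by (rule LIMSEQ_unique)
  have tc: "f (to_completion x) = h x" for x
    unfolding to_completion.abs_eq by (rule lim) (simp_all add: cnorm_Cauchy_const)
  have "unital_star_hom f"
    unfolding unital_star_hom_def
  proof (intro conjI allI)
    fix x y :: "'a completion" and c :: complex
    obtain X Y where X: "cnorm_Cauchy X" "x = abs_completion X"
      and Y: "cnorm_Cauchy Y" "y = abs_completion Y" by (meson completion_cases_abs)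
    have "x + y = abs_completion (\<lambda>n. X n + Y n)" "x * y = abs_completion (\<lambda>n. X n * Y n)"
      "c *\<^sub>C x = abs_completion (\<lambda>n. c *\<^sub>C X n)" "star x = abs_completion (\<lambda>n. star (X n))"
      using X Y by (simp_all add: plus_completion.abs_eq times_completion.abs_eq
          scaleC_completion.abs_eq star_completion.abs_eq completion_rel_refl)
    note eqs = this
    have bs: "bounded_linear (\<lambda>x :: 'b. c *\<^sub>C x)"
      by (rule bounded_linear_intro[of _ "cmod c"])
         (simp_all add: scaleC_add_right scaleR_scaleC scaleC_scaleC norm_scaleC mult.commute)
    show "f (x + y) = f x + f y" unfolding eqs
      by (rule lim) (use X Y conv in \<open>auto simp: unital_star_homD[OF h] intro!: cnorm_Cauchy_intros tendsto_add\<close>)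
    show "f (x * y) = f x * f y" unfolding eqs
      by (rule lim) (use X Y conv in \<open>auto simp: unital_star_homD[OF h] intro!: cnorm_Cauchy_intros tendsto_mult\<close>)
    show "f (c *\<^sub>C x) = c *\<^sub>C f x" unfolding eqs
      by (rule lim) (use X Y conv bounded_linear.tendsto[OF bs] in
          \<open>auto simp: unital_star_homD[OF h] intro!: cnorm_Cauchy_intros\<close>)
    show "f (star x) = star (f x)" unfolding eqs
      by (rule lim) (use X Y conv bounded_linear.tendsto[OF bounded_linear_star] in
          \<open>auto simp: unital_star_homD[OF h] intro!: cnorm_Cauchy_intros\<close>)
    show "f 1 = 1" using tc[of 1] unital_star_homD(5)[OF to_completion_hom] unital_star_homD(5)[OF h]
      by metis
  qed
  then show ?thesis using tc by blast
qed

definition word_eval :: "('g \<Rightarrow> 'b::star_algebra) \<Rightarrow> 'g word \<Rightarrow> 'b" where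
  "word_eval v w = prod_list (map (\<lambda>(g, s). if s then star (v g) else v g) (letters w))"

lemma word_eval_add: "word_eval v (w + w') = word_eval v w * word_eval v w'"
  by (simp add: word_eval_def plus_word_def)

lemma star_prod_list: "star (prod_list xs) = prod_list (rev (map star xs))"
  for xs :: "'b::star_algebra list"
  by (induction xs) (simp_all add: star_one star_mult)

lemma word_eval_inv: "word_eval v (inv_op w) = star (word_eval v w)"
  unfolding word_eval_def inv_op_word_def star_prod_list
  by (auto simp: rev_map comp_def case_prod_unfold star_star intro!: arg_cong[of _ _ prod_list])

definition free_eval :: "('g \<Rightarrow> 'b::star_algebra) \<Rightarrow> 'g free_star_algebra \<Rightarrow> 'b" where
  "free_eval v p = (\<Sum>m\<in>Poly_Mapping.keys p. Poly_Mapping.lookup p m *\<^sub>C word_eval v m)"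

lemma free_eval_superset:
  assumes "finite A" "Poly_Mapping.keys p \<subseteq> A"
  shows "free_eval v p = (\<Sum>m\<in>A. Poly_Mapping.lookup p m *\<^sub>C word_eval v m)"
  unfolding free_eval_def using assms
  by (intro sum.mono_neutral_left) (auto simp: in_keys_iff scaleC_zero_left)

lemma free_eval_hom: "unital_star_hom (free_eval v)"
proof -
  have add: "free_eval v (p + q) = free_eval v p + free_eval v q" for p q
    using free_eval_superset[of "Poly_Mapping.keys p \<union> Poly_Mapping.keys q" _ v] keys_add[of p q]
    by (simp add: lookup_add scaleC_add_left sum.distrib)
  have single: "free_eval v (Poly_Mapping.single m c) = c *\<^sub>C word_eval v m" for m c
    by (cases "c = 0") (simp_all add: free_eval_def scaleC_zero_left)
  have zero: "free_eval v 0 = 0" by (simp add: free_eval_def)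
  have scale: "free_eval v (c *\<^sub>C p) = c *\<^sub>C free_eval v p" for c p
    by (induction p rule: poly_mapping_add_induct)
       (simp_all add: zero single add scaleC_zero_right scaleC_single scaleC_add_right scaleC_scaleC
          scaleC_complex_def)
  have m1: "free_eval v (Poly_Mapping.single m c * q) = free_eval v (Poly_Mapping.single m c) * free_eval v q"
    for m c q
    by (induction q rule: poly_mapping_add_induct)
       (simp_all add: zero single add mult_single word_eval_add mult_scaleC_left mult_scaleC_right
         scaleC_scaleC distrib_left mult.commute[of c])
  have mult: "free_eval v (p * q) = free_eval v p * free_eval v q" for p q
    by (induction p rule: poly_mapping_add_induct) (simp_all add: zero m1 add distrib_right)
  have "free_eval v (star p) = star (free_eval v p)" for p
    by (induction p rule: poly_mapping_add_induct)
       (simp_all add: zero star_zero single star_single star_add add star_scaleC word_eval_inv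
         star_complex_def)
  moreover have "free_eval v 1 = 1"
  proof -
    have "word_eval v 0 = 1" by (simp add: word_eval_def zero_word_def)
    then show ?thesis using single[of 0 1] by (simp add: scaleC_one)
  qed
  ultimately show ?thesis unfolding unital_star_hom_def using add scale mult by blast
qed

lemma free_eval_gen: "free_eval v (free_gen g) = v g"
  by (simp add: free_eval_def free_gen_def word_eval_def scaleC_one)

lemma hom_star_ideal:
  assumes "unital_star_hom f" "\<And>r. r \<in> S \<Longrightarrow> f r = 0" "x \<in> star_ideal S"
  shows "f x = 0"
  using assms(3) by induction (use assms(2) in \<open>auto simp: unital_star_homD[OF assms(1)] star_zero\<close>)

lemma pol_su_hom_exists:
  fixes a c :: "'b::star_algebra"
  assumes "a * c = 0" "a * star c = 0" "c * star c = star c * c" "star a * a + star c * c = 1"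
    "a * star a = 1"
  shows "\<exists>h. unital_star_hom h \<and> h su_alpha = a \<and> h su_gamma = c"
proof -
  define v where "v g = (case g of Gen_alpha \<Rightarrow> a | Gen_gamma \<Rightarrow> c)" for g
  have v: "v Gen_alpha = a" "v Gen_gamma = c" by (simp_all add: v_def)
  note hom = free_eval_hom[of v]
  have 0: "free_eval v r = 0" if "r \<in> su_relators" for r
    using that assms
    by (auto simp: su_relators_def Let_def unital_star_homD[OF hom] free_eval_gen v)
  define h where "h x = free_eval v (rep_pol_su x)" for x
  have h: "h (abs_pol_su p) = free_eval v p" for p
  proof -
    have "rep_pol_su (abs_pol_su p) - p \<in> star_ideal su_relators"
      using Quotient3_rep_abs[OF Quotient3_pol_su, of p] by (simp add: star_ideal.zero)
    then show ?thesis
      using hom_star_ideal[OF hom 0, of su_relators]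
      unfolding h_def by (metis unital_star_homD(8)[OF hom] eq_iff_diff_eq_0)
  qed
  have ex: "\<exists>p. x = abs_pol_su p" for x
    by (metis Quotient3_abs_rep[OF Quotient3_pol_su])
  have "unital_star_hom h"
    unfolding unital_star_hom_def
  proof (intro conjI allI)
    fix x y z
    obtain p q where "x = abs_pol_su p" "y = abs_pol_su q" using ex by metis
    then show "h (x + y) = h x + h y" "h (x * y) = h x * h y" "h (star x) = star (h x)"
      "h (z *\<^sub>C x) = z *\<^sub>C h x"
      by (simp_all flip: abs_pol_su_hom add: h unital_star_homD[OF hom])
  next
    show "h 1 = 1" using h[of 1] by (simp add: abs_pol_su_hom unital_star_homD[OF hom])
  qed
  moreover have "h su_alpha = a" "h su_gamma = c"
    by (simp_all add: su_alpha_def su_gamma_def h free_eval_gen v)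
  ultimately show ?thesis by blast
qed

lemma cstar_seminorm_le_cnorm_pol_su:
  assumes "cstar_seminorm p"
  shows "p (x :: pol_su) \<le> cnorm x"
  unfolding cnorm_pol_su_def
proof (rule cSUP_upper)
  show "bdd_above ((\<lambda>p. p x) ` {p. cstar_seminorm p})"
    using pol_su_bounded[of x] by (auto simp: star_algebra_bounded_def bdd_above_def)
qed (use assms in simp)

lemma to_completion_relations:
  "c_alpha * c_gamma = 0" "c_alpha * star c_gamma = 0" "c_gamma * star c_gamma = star c_gamma * c_gamma"
  "star c_alpha * c_alpha + star c_gamma * c_gamma = 1" "c_alpha * star c_alpha = 1"
  unfolding c_alpha_def c_gamma_def
  by (simp_all flip: unital_star_homD[OF to_completion_hom] add: pol_su_relations)

lemma c_su_universal:
  fixes a c :: "'b::cstar_algebra"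
  assumes "a * c = 0" "a * star c = 0" "c * star c = star c * c" "star a * a + star c * c = 1"
    "a * star a = 1"
  shows "\<exists>!f. unital_star_hom f \<and> f c_alpha = a \<and> f c_gamma = c"
proof -
  obtain h where h: "unital_star_hom h" "h su_alpha = a" "h su_gamma = c"
    using pol_su_hom_exists[OF assms] by blast
  have "cstar_seminorm (\<lambda>x. norm (h x))"
    by (rule cstar_seminorm_comp[OF cstar_seminorm_norm h(1)])
  from cstar_seminorm_le_cnorm_pol_su[OF this] obtain f where
    f: "unital_star_hom f" "\<And>x. f (to_completion x) = h x"
    using completion_hom_exists[OF h(1)] by blast
  show ?thesis
  proof (rule ex1I)
    show "unital_star_hom f \<and> f c_alpha = a \<and> f c_gamma = c"
      using f h by (simp add: c_alpha_def c_gamma_def)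
    fix g assume g: "unital_star_hom g \<and> g c_alpha = a \<and> g c_gamma = c"
    have "g (to_completion x) = f (to_completion x)" if "x \<in> star_subalgebra {su_alpha, su_gamma}" for x
      using that
    proof induction
      case (gen x)
      then show ?case using g f h by (auto simp: c_alpha_def c_gamma_def)
    qed (use g f(1) in \<open>simp_all add: unital_star_homD[OF to_completion_hom] unital_star_homD[OF f(1)]
            unital_star_homD[OF conjunct1[OF g]]\<close>)
    then show "g = f" using pol_su_generated g f(1) by (intro completion_hom_unique) auto
  qed
qed

lemma tensor_simps:
  fixes a a' :: "'a::cstar_algebra" and b b' :: "'b::cstar_algebra"
  shows "(a + a') \<otimes> b = a \<otimes> b + a' \<otimes> b" "a \<otimes> (b + b') = a \<otimes> b + a \<otimes> b'"
    "(c *\<^sub>C a) \<otimes> b = c *\<^sub>C (a \<otimes> b)" "a \<otimes> (c *\<^sub>C b) = c *\<^sub>C (a \<otimes> b)"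
    "(a \<otimes> b) * (a' \<otimes> b') = (a * a') \<otimes> (b * b')" "star (a \<otimes> b) = star a \<otimes> star b"
    "1 \<otimes> 1 = (1 :: ('a, 'b) cstar_tensor)"
  unfolding tensor_def
  by (simp_all add: pure_tensor_simps unital_star_homD[OF to_completion_hom] flip: unital_star_homD[OF to_completion_hom])

lemma comult_unique_existence:
  "\<exists>!D :: c_su \<Rightarrow> (c_su, c_su) cstar_tensor.
    unital_star_hom D \<and> D c_alpha = c_alpha \<otimes> c_alpha \<and> D c_gamma = c_gamma \<otimes> c_alpha + star c_alpha \<otimes> c_gamma"
proof (rule c_su_universal)
  let ?a = "c_alpha" and ?c = "c_gamma"
  have z: "0 \<otimes> x = (0 :: (c_su, c_su) cstar_tensor)" "x \<otimes> 0 = (0 :: (c_su, c_su) cstar_tensor)" for x :: c_su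
    using tensor_simps(3)[of 0 0 x] tensor_simps(4)[of x 0 0] by (simp_all add: scaleC_zero_left)
  have r: "star ?c * star ?a = 0" "?c * star ?a = 0"
    using arg_cong[OF to_completion_relations(1), of star] arg_cong[OF to_completion_relations(2), of star]
    by (simp_all add: star_mult star_zero star_star)
  note R = to_completion_relations(1-3,5) r
  let ?D = "?c \<otimes> ?a + star ?a \<otimes> ?c"
  have sD: "star ?D = star ?c \<otimes> star ?a + ?a \<otimes> star ?c"
    by (simp add: star_add tensor_simps star_star)
  show "(?a \<otimes> ?a) * ?D = 0"
    by (simp add: distrib_left tensor_simps R z)
  show "(?a \<otimes> ?a) * star ?D = 0"
    unfolding sD by (simp add: distrib_left tensor_simps R z)
  show "(?a \<otimes> ?a) * star (?a \<otimes> ?a) = 1"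
    by (simp add: tensor_simps R)
  have e: "star ?a * ?a = 1 - star ?c * ?c"
    using to_completion_relations(4) by (simp add: eq_diff_eq)
  have d: "(x - y) \<otimes> w = x \<otimes> w - y \<otimes> w" "w \<otimes> (x - y) = w \<otimes> x - w \<otimes> y" for x y w :: c_su
    using tensor_simps(1)[of "x - y" y w] tensor_simps(2)[of w "x - y" y] by (simp_all add: eq_diff_eq)
  show "?D * star ?D = star ?D * ?D"
    unfolding sD by (simp add: distrib_left distrib_right tensor_simps R z e d algebra_simps)
  show "star (?a \<otimes> ?a) * (?a \<otimes> ?a) + star ?D * ?D = 1"
    unfolding sD by (simp add: distrib_left distrib_right tensor_simps R z e d algebra_simps)
qed

definition comult :: "c_su \<Rightarrow> (c_su, c_su) cstar_tensor" where
  "comult = (THE D. unital_star_hom D \<and>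
     D c_alpha = c_alpha \<otimes> c_alpha \<and> D c_gamma = c_gamma \<otimes> c_alpha + star c_alpha \<otimes> c_gamma)"

definition pol_so :: "pol_su set" where
  "pol_so = star_subalgebra {su_alpha\<^sup>2, su_gamma\<^sup>2, su_gamma * su_alpha, star su_gamma * su_alpha,
     star su_gamma * su_gamma}"

definition c_so :: "c_su set" where
  "c_so = closure (to_completion ` pol_so)"

lemma circle_map_unique_existence:
  "\<exists>!j :: c_su \<Rightarrow> complex \<Rightarrow> complex.
     (\<forall>x. continuous_on (sphere 0 1) (j x) \<and> (\<forall>z. z \<notin> sphere 0 1 \<longrightarrow> j x z = 0)) \<and>
     (\<forall>z\<in>sphere 0 1. unital_star_hom (\<lambda>x. j x z) \<and> j c_alpha z = z \<and> j c_gamma z = 0)"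
proof -
  have ex1: "\<exists>!f :: c_su \<Rightarrow> complex. unital_star_hom f \<and> f c_alpha = z \<and> f c_gamma = 0"
    if "z \<in> sphere 0 1" for z :: complex
    using that
    by (intro c_su_universal) (auto simp: star_complex_def complex_norm_square[symmetric] mult.commute)
  define ch where "ch z = (THE f :: c_su \<Rightarrow> complex. unital_star_hom f \<and> f c_alpha = z \<and> f c_gamma = 0)" for z
  have ch: "unital_star_hom (ch z)" "ch z c_alpha = z" "ch z c_gamma = 0" if "z \<in> sphere 0 1" for z
    using theI'[OF ex1[OF that]] unfolding ch_def by auto
  define j where "j x z = (if z \<in> sphere 0 1 then ch z x else 0)" for x z
  let ?C = "{x. continuous_on (sphere 0 1) (j x)}"
  have pol: "continuous_on (sphere 0 1) (j (to_completion x))"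
    if "x \<in> star_subalgebra {su_alpha, su_gamma}" for x
    using that
  proof induction
    case (gen x)
    have "continuous_on (sphere 0 1) (j c_alpha)" "continuous_on (sphere 0 1) (j c_gamma)"
      by (rule continuous_on_eq[of _ "\<lambda>z. z"] continuous_on_eq[of _ "\<lambda>z. 0"];
          simp add: j_def ch del: mem_sphere_0)+
    then show ?case using gen by (auto simp: c_alpha_def c_gamma_def)
  next
    case one
    show ?case
      by (rule continuous_on_eq[of _ "\<lambda>z. 1"])
         (simp_all add: j_def unital_star_homD[OF ch(1)] unital_star_homD[OF to_completion_hom] del: mem_sphere_0)
  next
    case (add x y)
    show ?case
      by (rule continuous_on_eq[OF continuous_on_add[OF add.IH]])
         (simp_all add: j_def unital_star_homD[OF ch(1)] unital_star_homD[OF to_completion_hom] del: mem_sphere_0)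
  next
    case (scale x c)
    show ?case
      by (rule continuous_on_eq[OF continuous_on_mult_left[OF scale.IH, of c]])
         (simp_all add: j_def unital_star_homD[OF ch(1)] unital_star_homD[OF to_completion_hom]
            scaleC_complex_def del: mem_sphere_0)
  next
    case (mult x y)
    show ?case
      by (rule continuous_on_eq[OF continuous_on_mult[OF mult.IH]])
         (simp_all add: j_def unital_star_homD[OF ch(1)] unital_star_homD[OF to_completion_hom] del: mem_sphere_0)
  next
    case (star x)
    show ?case
      by (rule continuous_on_eq[OF continuous_on_cnj[OF star.IH]])
         (simp_all add: j_def unital_star_homD[OF ch(1)] unital_star_homD[OF to_completion_hom]
            star_complex_def del: mem_sphere_0)
  qed
  have cont: "continuous_on (sphere 0 1) (j x)" for x
  proof -
    have "x \<in> closure (range to_completion)" by (simp add: closure_range_to_completion)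
    then obtain y where "\<And>n. y n \<in> range to_completion" and lim: "y \<longlonglongrightarrow> x"
      unfolding closure_sequential by blast
    then have y: "continuous_on (sphere 0 1) (j (y n))" for n
      using pol pol_su_generated by (metis imageE)
    have "uniform_limit (sphere 0 1) (\<lambda>n. j (y n)) (j x) sequentially"
    proof (rule uniform_limitI)
      fix e :: real assume "e > 0"
      then have "\<forall>\<^sub>F n in sequentially. dist (y n) x < e" using lim by (rule tendstoD[rotated])
      then show "\<forall>\<^sub>F n in sequentially. \<forall>z\<in>sphere 0 1. dist (j (y n) z) (j x z) < e"
      proof eventually_elim
        case (elim n)
        show ?case
        proof
          fix z :: complex assume z: "z \<in> sphere 0 1"
          then have "dist (j (y n) z) (j x z) = norm (ch z (y n - x))"
            by (simp add: j_def dist_norm unital_star_homD[OF ch(1)] del: mem_sphere_0)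
          also have "\<dots> \<le> norm (y n - x)" by (rule unital_star_hom_norm[OF ch(1)[OF z]])
          finally show "dist (j (y n) z) (j x z) < e" using elim by (simp add: dist_norm)
        qed
      qed
    qed
    then show ?thesis by (rule uniform_limit_theorem[rotated]) (simp_all add: y)
  qed
  show ?thesis
  proof (rule ex1I[of _ j])
    show "(\<forall>x. continuous_on (sphere 0 1) (j x) \<and> (\<forall>z. z \<notin> sphere 0 1 \<longrightarrow> j x z = 0)) \<and>
     (\<forall>z\<in>sphere 0 1. unital_star_hom (\<lambda>x. j x z) \<and> j c_alpha z = z \<and> j c_gamma z = 0)"
      using cont ch by (auto simp: j_def simp del: mem_sphere_0)
  next
    fix k :: "c_su \<Rightarrow> complex \<Rightarrow> complex"
    assume k: "(\<forall>x. continuous_on (sphere 0 1) (k x) \<and> (\<forall>z. z \<notin> sphere 0 1 \<longrightarrow> k x z = 0)) \<and>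
     (\<forall>z\<in>sphere 0 1. unital_star_hom (\<lambda>x. k x z) \<and> k c_alpha z = z \<and> k c_gamma z = 0)"
    have "k x z = j x z" for x z
    proof (cases "z \<in> sphere 0 1")
      case True
      then have "(\<lambda>x. k x z) = ch z" using ex1[OF True] k ch[OF True] by blast
      then show ?thesis using True by (simp add: j_def fun_eq_iff del: mem_sphere_0)
    qed (use k in \<open>simp add: j_def\<close>)
    then show "k = j" by (intro ext)
  qed
qed

text \<open>
  The homomorphism \<open>j\<close> onto \<open>C(U(1))\<close>; a continuous function on the unit circle is represented by
  its extension by zero to all complex numbers.
\<close>

definition circle_map :: "c_su \<Rightarrow> complex \<Rightarrow> complex" where
  "circle_map = (THE j.
     (\<forall>x. continuous_on (sphere 0 1) (j x) \<and> (\<forall>z. z \<notin> sphere 0 1 \<longrightarrow> j x z = 0)) \<and>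
     (\<forall>z\<in>sphere 0 1. unital_star_hom (\<lambda>x. j x z) \<and> j c_alpha z = z \<and> j c_gamma z = 0))"

definition phi_state :: "nat \<Rightarrow> c_su \<Rightarrow> complex" where
  "phi_state n x = (1 / of_nat n) * (\<Sum>z | z ^ n = 1. circle_map x z)"

end

theory Submission
  imports Defs
begin

text \<open>
  Let \<open>\<sigma>\<close> be the automorphism of \<open>C(SU\<^sub>0(2))\<close> with \<open>\<alpha> \<mapsto> -\<alpha>\<close> and \<open>\<gamma> \<mapsto> -\<gamma>\<close>. The algebra \<open>C(SO\<^sub>0(3))\<close> is
  its fixed point algebra, so \<open>E = (id + \<sigma>) / 2\<close> is a projection of \<open>C(SU\<^sub>0(2))\<close> onto \<open>C(SO\<^sub>0(3))\<close>. As
  \<open>(\<sigma> \<otimes> id) \<circ> \<Delta> = \<Delta> \<circ> \<sigma> = (id \<otimes> \<sigma>) \<circ> \<Delta>\<close>, also \<open>(E \<otimes> E) \<circ> \<Delta> = \<Delta> \<circ> E\<close>, and \<open>f \<circ> E\<close> is an idempotent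
  state on \<open>C(SU\<^sub>0(2))\<close> extending the idempotent state \<open>f\<close>. On the circle, \<open>\<sigma>\<close> becomes \<open>z \<mapsto> -z\<close>, so
  \<open>j(x)\<close> is even for \<open>x\<close> in \<open>C(SO\<^sub>0(3))\<close>; for odd \<open>n\<close> the \<open>2n\<close>-th roots of unity are the numbers
  \<open>\<plusminus>z\<close> with \<open>z\<^sup>n = 1\<close>.
\<close>

section \<open>Tensor products of automorphisms\<close>

lemma unital_star_hom_comp:
  assumes "unital_star_hom g" "unital_star_hom f"
  shows "unital_star_hom (\<lambda>x. g (f x))"
  using assms by (simp add: unital_star_hom_def)

lemma unital_star_hom_id: "unital_star_hom (\<lambda>x. x)"
  by (simp add: unital_star_hom_def)

text \<open>The linear extension of \<open>t\<close> to the monoid algebra of pairs, of which the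
  algebraic tensor product is a quotient.\<close>

definition elem_tensor_eval ::
    "('a::star_algebra \<Rightarrow> 'b::star_algebra \<Rightarrow> 'c::star_algebra) \<Rightarrow>
     (('a, 'b) elem_tensor \<Rightarrow>\<^sub>0 complex) \<Rightarrow> 'c" where
  "elem_tensor_eval t p =
     (\<Sum>m\<in>Poly_Mapping.keys p. Poly_Mapping.lookup p m *\<^sub>C t (tfst m) (tsnd m))"

lemma elem_tensor_eval_superset:
  assumes "finite A" "Poly_Mapping.keys p \<subseteq> A"
  shows "elem_tensor_eval t p = (\<Sum>m\<in>A. Poly_Mapping.lookup p m *\<^sub>C t (tfst m) (tsnd m))"
  unfolding elem_tensor_eval_def using assms
  by (intro sum.mono_neutral_left) (auto simp: in_keys_iff scaleC_zero_left)

lemma elem_tensor_eval_single: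
  "elem_tensor_eval t (Poly_Mapping.single m c) = c *\<^sub>C t (tfst m) (tsnd m)"
  by (cases "c = 0") (simp_all add: elem_tensor_eval_def scaleC_zero_left)

lemma elem_tensor_eval_hom:
  assumes mult: "\<And>a b a' b'. t (a * a') (b * b') = t a b * t a' b'"
    and star: "\<And>a b. t (star a) (star b) = star (t a b)"
    and one: "t 1 1 = 1"
  shows "unital_star_hom (elem_tensor_eval t)"
proof -
  note single = elem_tensor_eval_single[of t]
  have add: "elem_tensor_eval t (p + q) = elem_tensor_eval t p + elem_tensor_eval t q" for p q
    using elem_tensor_eval_superset[of "Poly_Mapping.keys p \<union> Poly_Mapping.keys q" _ t]
      keys_add[of p q]
    by (simp add: lookup_add scaleC_add_left sum.distrib)
  have zero: "elem_tensor_eval t 0 = 0" by (simp add: elem_tensor_eval_def)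
  have scale: "elem_tensor_eval t (c *\<^sub>C p) = c *\<^sub>C elem_tensor_eval t p" for c p
    by (induction p rule: poly_mapping_add_induct)
       (simp_all add: zero single add scaleC_zero_right scaleC_single scaleC_add_right scaleC_scaleC
          scaleC_complex_def)
  \<comment> \<open>Multiplicativity is shown first for a single pair on the left; additivity then
    gives all left factors.\<close>
  have m1: "elem_tensor_eval t (Poly_Mapping.single m c * q) =
      elem_tensor_eval t (Poly_Mapping.single m c) * elem_tensor_eval t q" for m c q
    by (induction q rule: poly_mapping_add_induct)
       (simp_all add: zero single add mult_single plus_elem_tensor_def mult mult_scaleC_left
         mult_scaleC_right scaleC_scaleC distrib_left mult.commute[of c])
  have "elem_tensor_eval t (p * q) = elem_tensor_eval t p * elem_tensor_eval t q" for p q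
    by (induction p rule: poly_mapping_add_induct) (simp_all add: zero m1 add distrib_right)
  moreover have "elem_tensor_eval t (star p) = star (elem_tensor_eval t p)" for p
    by (induction p rule: poly_mapping_add_induct)
       (simp_all add: zero star_zero single star_single star_add add star_scaleC
         inv_op_elem_tensor_def star star_complex_def)
  moreover have "elem_tensor_eval t 1 = 1"
    using single[of 0 1] unfolding single_one by (simp add: scaleC_one zero_elem_tensor_def one)
  ultimately show ?thesis unfolding unital_star_hom_def using add scale by blast
qed

text \<open>The universal property of the algebraic tensor product: bilinearity makes the evaluation
  vanish on \<open>tensor_relators\<close>, hence on the ideal they generate, so it descends to the
  quotient.\<close>

lemma alg_tensor_hom_exists:
  fixes t :: "'a::star_algebra \<Rightarrow> 'b::star_algebra \<Rightarrow> 'c::star_algebra"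
  assumes hom: "\<And>a b a' b'. t (a * a') (b * b') = t a b * t a' b'"
      "\<And>a b. t (star a) (star b) = star (t a b)" "t 1 1 = 1"
    and bilinear: "\<And>a a' b. t (a + a') b = t a b + t a' b" "\<And>a b b'. t a (b + b') = t a b + t a b'"
      "\<And>c a b. t (c *\<^sub>C a) b = c *\<^sub>C t a b" "\<And>c a b. t a (c *\<^sub>C b) = c *\<^sub>C t a b"
  shows "\<exists>h. unital_star_hom h \<and> (\<forall>a b. h (pure_tensor a b) = t a b)"
proof -
  note H = elem_tensor_eval_hom[of t, OF hom]
  have 0: "elem_tensor_eval t r = 0" if "r \<in> tensor_relators" for r
    using that unfolding tensor_relators_def Let_def
    by (auto simp: unital_star_homD[OF H] elem_tensor_eval_single bilinear scaleC_one)
  define h where "h x = elem_tensor_eval t (rep_alg_tensor x)" for x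
  have h: "h (abs_alg_tensor p) = elem_tensor_eval t p" for p
  proof -
    have "rep_alg_tensor (abs_alg_tensor p) - p \<in> star_ideal tensor_relators"
      using Quotient3_rep_abs[OF Quotient3_alg_tensor, of p] by (simp add: star_ideal.zero)
    then show ?thesis
      using hom_star_ideal[OF H 0, of tensor_relators]
      unfolding h_def by (metis unital_star_homD(8)[OF H] eq_iff_diff_eq_0)
  qed
  have ex: "\<exists>p. x = abs_alg_tensor p" for x :: "('a, 'b) alg_tensor"
    by (metis Quotient3_abs_rep[OF Quotient3_alg_tensor])
  have "unital_star_hom h"
    unfolding unital_star_hom_def
  proof (intro conjI allI)
    fix x y :: "('a, 'b) alg_tensor" and c
    obtain p q where "x = abs_alg_tensor p" "y = abs_alg_tensor q" using ex by metis
    then show "h (x + y) = h x + h y" "h (x * y) = h x * h y" "h (star x) = star (h x)"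
      "h (c *\<^sub>C x) = c *\<^sub>C h x"
      by (simp_all add: plus_alg_tensor.abs_eq times_alg_tensor.abs_eq star_alg_tensor.abs_eq
          scaleC_alg_tensor.abs_eq h unital_star_homD[OF H])
  next
    show "h 1 = 1" unfolding one_alg_tensor_def by (simp add: h unital_star_homD[OF H])
  qed
  moreover have "h (pure_tensor a b) = t a b" for a b
    by (simp add: pure_tensor.abs_eq h elem_tensor_eval_single scaleC_one)
  ultimately show ?thesis by blast
qed

lemma unital_star_hom_eq_on_subalgebra:
  assumes f: "unital_star_hom f" and g: "unital_star_hom g"
    and S: "\<And>x. x \<in> S \<Longrightarrow> f x = g x" and x: "x \<in> star_subalgebra S"
  shows "f x = g x"
  using x by induction (simp_all add: S unital_star_homD[OF f] unital_star_homD[OF g])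

text \<open>Being its own inverse, \<open>H\<close> maps the index set of the left supremum onto
  that of the right one; substituting \<open>H y\<close> for \<open>y\<close> identifies the
  two.\<close>

lemma gns_seminorm_comp_automorphism:
  assumes H: "unital_star_hom H" and inv: "\<And>x. H (H x) = x"
  shows "gns_seminorm (\<lambda>x. w (H x)) x = gns_seminorm w (H x)"
proof -
  have "(\<lambda>y. sqrt (Re (w (H (star (x * y) * (x * y)))))) ` {y. Re (w (H (star y * y))) \<le> 1} =
      (\<lambda>y. sqrt (Re (w (star (H x * y) * (H x * y))))) ` H ` {y. Re (w (H (star y * y))) \<le> 1}"
    by (simp add: image_image unital_star_homD[OF H])
  also have "H ` {y. Re (w (H (star y * y))) \<le> 1} = {y. Re (w (star y * y)) \<le> 1}"
  proof (intro set_eqI iffI)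
    fix y assume "y \<in> {y. Re (w (star y * y)) \<le> 1}"
    then have "y = H (H y)" "H y \<in> {y. Re (w (H (star y * y))) \<le> 1}"
      by (simp_all add: unital_star_homD[OF H] inv)
    then show "y \<in> H ` {y. Re (w (H (star y * y))) \<le> 1}" by blast
  qed (auto simp: unital_star_homD[OF H])
  finally show ?thesis unfolding gns_seminorm_def by (rule arg_cong[of _ _ Sup])
qed

lemma state_on_comp_hom:
  assumes "state_on UNIV f" "unital_star_hom h"
  shows "state_on UNIV (\<lambda>x. f (h x))"
  using assms(1) unfolding state_on_def clinear_on_def by (simp add: unital_star_homD[OF assms(2)])

text \<open>The algebraic map \<open>H\<close> extends to the completion once it is contractive for
  the spatial norm. This norm is a supremum of seminorms, and composition with \<open>H\<close> maps
  their family into itself.\<close>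

lemma tensor_automorphism_exists:
  fixes h :: "'a::cstar_algebra \<Rightarrow> 'a" and k :: "'b::cstar_algebra \<Rightarrow> 'b"
  assumes h: "unital_star_hom h" and k: "unital_star_hom k"
    and hh: "\<And>x. h (h x) = x" and kk: "\<And>x. k (k x) = x"
  shows "\<exists>T :: ('a, 'b) cstar_tensor \<Rightarrow> ('a, 'b) cstar_tensor.
    unital_star_hom T \<and> (\<forall>a b. T (a \<otimes> b) = h a \<otimes> k b)"
proof -
  obtain H :: "('a, 'b) alg_tensor \<Rightarrow> ('a, 'b) alg_tensor"
    where H: "unital_star_hom H" "\<And>a b. H (pure_tensor a b) = pure_tensor (h a) (k b)"
    using alg_tensor_hom_exists[of "\<lambda>a b. pure_tensor (h a) (k b)"]
    by (auto simp: unital_star_homD[OF h] unital_star_homD[OF k] pure_tensor_simps)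
  have HH: "H (H x) = x" for x
    by (rule unital_star_hom_eq_on_subalgebra[OF unital_star_hom_comp[OF H(1) H(1)]
          unital_star_hom_id _ alg_tensor_generated])
       (auto simp: H(2) hh kk)
  let ?P = "insert (\<lambda>_. 0)
    {p. cstar_seminorm p \<and> (\<exists>w :: ('a, 'b) alg_tensor \<Rightarrow> complex. product_state w \<and> p = gns_seminorm w)}"
  have P: "cstar_seminorm p" if "p \<in> ?P" for p
    using that cstar_seminorm_zero_map by auto
  \<comment> \<open>If \<open>w\<close> is the product of the states \<open>f\<close> and
    \<open>g\<close>, then \<open>w\<close> after \<open>H\<close> is the product of
    \<open>f\<close> after \<open>h\<close> and \<open>g\<close> after \<open>k\<close>.\<close>
  have comp: "(\<lambda>x. p (H x)) \<in> ?P" if p: "p \<in> ?P" for p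
  proof (cases "p = (\<lambda>_. 0)")
    case False
    then obtain w where w: "cstar_seminorm p" "product_state w" "p = gns_seminorm w" using p by auto
    have "product_state (\<lambda>x. w (H x))"
    proof -
      obtain f g where fg: "state_on UNIV f" "state_on UNIV g"
        "\<And>a b. w (pure_tensor a b) = f a * g b"
        using w(2) unfolding product_state_def by blast
      have "clinear_on UNIV (\<lambda>x. w (H x))"
        using w(2) unfolding product_state_def clinear_on_def by (simp add: unital_star_homD[OF H(1)])
      then show ?thesis
        unfolding product_state_def
        using state_on_comp_hom[OF fg(1) h] state_on_comp_hom[OF fg(2) k]
        by (intro conjI exI[of _ "\<lambda>x. f (h x)"] exI[of _ "\<lambda>x. g (k x)"]) (simp_all add: H(2) fg(3))
    qed
    moreover have "(\<lambda>x. p (H x)) = gns_seminorm (\<lambda>x. w (H x))"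
      by (simp add: fun_eq_iff gns_seminorm_comp_automorphism[OF H(1) HH] w(3))
    ultimately show ?thesis using cstar_seminorm_comp[OF w(1) H(1)] by auto
  qed simp
  have le: "cnorm (H x) \<le> cnorm x" for x
  proof -
    \<comment> \<open>A real supremum is an upper bound only of a bounded family; all
      \<open>cstar_seminorm\<close> values at \<open>x\<close> share one bound.\<close>
    have bdd: "bdd_above ((\<lambda>p. p x) ` ?P)"
    proof -
      obtain M where "\<And>p. cstar_seminorm p \<Longrightarrow> p x \<le> M"
        using alg_tensor_bounded unfolding star_algebra_bounded_def by blast
      then show ?thesis using P by (intro bdd_aboveI2[of _ _ M]) blast
    qed
    show ?thesis
      unfolding cnorm_alg_tensor_def
    proof (rule cSUP_least)
      fix p assume "p \<in> ?P"
      from cSUP_upper[OF comp[OF this] bdd] show "p (H x) \<le> (SUP p\<in>?P. p x)" .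
    qed simp
  qed
  have "\<exists>T. unital_star_hom T \<and> (\<forall>x. T (to_completion x) = to_completion (H x))"
    by (rule completion_hom_exists[OF unital_star_hom_comp[OF to_completion_hom H(1)]])
       (simp add: norm_to_completion le)
  then show ?thesis by (auto simp: tensor_def H(2))
qed

section \<open>The sign automorphism\<close>

text \<open>The two generators determine a homomorphism on the dense image of the polynomials, and
  continuity does the rest. Identities between homomorphisms are thereby checked on
  generators.\<close>

lemma c_su_hom_unique:
  fixes f g :: "c_su \<Rightarrow> 'b::cstar_algebra"
  assumes f: "unital_star_hom f" and g: "unital_star_hom g"
    and "f c_alpha = g c_alpha" "f c_gamma = g c_gamma"
  shows "f = g"
proof -
  have "f (to_completion x) = g (to_completion x)" for x
    by (rule unital_star_hom_eq_on_subalgebra[OF unital_star_hom_comp[OF f to_completion_hom]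
          unital_star_hom_comp[OF g to_completion_hom] _ pol_su_generated])
       (use assms(3,4) in \<open>auto simp: c_alpha_def c_gamma_def\<close>)
  then show ?thesis by (rule completion_hom_unique[OF f g])
qed

definition sign_aut :: "c_su \<Rightarrow> c_su" where
  "sign_aut = (THE f. unital_star_hom f \<and> f c_alpha = - c_alpha \<and> f c_gamma = - c_gamma)"

text \<open>Every term of the defining relations has even degree, so the relations survive the
  change of both signs.\<close>

lemma sign_aut:
  shows sign_aut_hom: "unital_star_hom sign_aut"
    and sign_aut_alpha: "sign_aut c_alpha = - c_alpha"
    and sign_aut_gamma: "sign_aut c_gamma = - c_gamma"
proof -
  have "\<exists>!f :: c_su \<Rightarrow> c_su. unital_star_hom f \<and> f c_alpha = - c_alpha \<and> f c_gamma = - c_gamma"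
    by (rule c_su_universal) (simp_all add: star_uminus to_completion_relations)
  from theI'[OF this] show "unital_star_hom sign_aut" "sign_aut c_alpha = - c_alpha"
    "sign_aut c_gamma = - c_gamma"
    unfolding sign_aut_def by simp_all
qed

lemmas sign_aut_simps = unital_star_homD[OF sign_aut_hom] sign_aut_alpha sign_aut_gamma

lemma sign_aut_involutive: "sign_aut (sign_aut x) = x"
proof -
  have "(\<lambda>x. sign_aut (sign_aut x)) = (\<lambda>x. x)"
    by (rule c_su_hom_unique)
       (simp_all add: unital_star_hom_comp sign_aut_hom unital_star_hom_id sign_aut_simps)
  then show ?thesis by (simp add: fun_eq_iff)
qed

section \<open>The projection onto the fixed points of the sign automorphism\<close>

definition even_part :: "c_su \<Rightarrow> c_su" where
  "even_part x = (1 / 2) *\<^sub>R (x + sign_aut x)"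

lemma even_part_add: "even_part (x + y) = even_part x + even_part y"
  by (simp add: even_part_def sign_aut_simps algebra_simps)

lemma even_part_scaleC: "even_part (c *\<^sub>C x) = c *\<^sub>C even_part x"
  by (simp add: even_part_def sign_aut_simps scaleR_scaleC scaleC_scaleC mult.commute
      flip: scaleC_add_right)

lemma continuous_on_even_part: "continuous_on A even_part"
  unfolding even_part_def
  by (intro continuous_intros unital_star_hom_continuous sign_aut_hom)

lemma even_part_fixed: "sign_aut x = x \<Longrightarrow> even_part x = x"
  by (simp add: even_part_def flip: scaleR_2)

lemma sign_aut_even_part: "sign_aut (even_part x) = even_part x"
  by (simp add: even_part_def scaleR_scaleC sign_aut_simps sign_aut_involutive add.commute)

text \<open>Each generator of \<open>pol_so\<close> is a product of two letters, whose signs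
  cancel.\<close>

lemma sign_aut_pol_so:
  assumes "x \<in> pol_so"
  shows "sign_aut (to_completion x) = to_completion x"
  by (rule unital_star_hom_eq_on_subalgebra[OF unital_star_hom_comp[OF sign_aut_hom to_completion_hom]
        to_completion_hom _ assms[unfolded pol_so_def]])
     (auto simp: unital_star_homD[OF to_completion_hom] power2_eq_square sign_aut_simps star_uminus
       simp flip: c_alpha_def c_gamma_def)

lemma sign_aut_c_so:
  assumes "x \<in> c_so"
  shows "sign_aut x = x"
proof -
  have "closed {x. sign_aut x = x}"
    by (intro closed_Collect_eq continuous_on_id unital_star_hom_continuous sign_aut_hom)
  then have "c_so \<subseteq> {x. sign_aut x = x}"
    unfolding c_so_def by (intro closure_minimal) (auto simp: sign_aut_pol_so)
  then show ?thesis using assms by blast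
qed

section \<open>Even and odd polynomials\<close>

definition su_letters :: "pol_su set" where
  "su_letters = {su_alpha, star su_alpha, su_gamma, star su_gamma}"

lemma pol_so_simps:
  "1 \<in> pol_so" "x \<in> pol_so \<Longrightarrow> y \<in> pol_so \<Longrightarrow> x + y \<in> pol_so"
  "x \<in> pol_so \<Longrightarrow> y \<in> pol_so \<Longrightarrow> x * y \<in> pol_so" "x \<in> pol_so \<Longrightarrow> c *\<^sub>C x \<in> pol_so"
  "x \<in> pol_so \<Longrightarrow> star x \<in> pol_so" "0 \<in> pol_so"
  "x \<in> pol_so \<Longrightarrow> y \<in> pol_so \<Longrightarrow> x - y \<in> pol_so"
proof -
  show 1: "1 \<in> pol_so" and add: "x \<in> pol_so \<Longrightarrow> y \<in> pol_so \<Longrightarrow> x + y \<in> pol_so"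
    and "x \<in> pol_so \<Longrightarrow> y \<in> pol_so \<Longrightarrow> x * y \<in> pol_so"
    and sc: "x \<in> pol_so \<Longrightarrow> c *\<^sub>C x \<in> pol_so"
    and "x \<in> pol_so \<Longrightarrow> star x \<in> pol_so" for x y c
    unfolding pol_so_def by (rule star_subalgebra.intros; assumption)+
  show "0 \<in> pol_so" using sc[OF 1, of 0] by (simp add: scaleC_zero_left)
  show "x \<in> pol_so \<Longrightarrow> y \<in> pol_so \<Longrightarrow> x - y \<in> pol_so"
    using add[OF _ sc[of y "- 1"], of x] by (simp add: scaleC_minus_one)
qed

lemma star_su_letters: "g \<in> su_letters \<Longrightarrow> star g \<in> su_letters"
  by (auto simp: su_letters_def star_star)

text \<open>Each of the sixteen products is a generator of \<open>pol_so\<close>, the adjoint of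
  one, or reduced by the relations to 0, 1, \<open>star su_gamma * su_gamma\<close> or 1 minus the
  latter.\<close>

lemma su_letters_mult:
  assumes "g \<in> su_letters" "g' \<in> su_letters"
  shows "g * g' \<in> pol_so"
proof -
  let ?a = su_alpha and ?c = su_gamma
  have gen: "?a * ?a \<in> pol_so" "?c * ?c \<in> pol_so" "?c * ?a \<in> pol_so" "star ?c * ?a \<in> pol_so"
    "star ?c * ?c \<in> pol_so"
    unfolding pol_so_def by (rule star_subalgebra.gen; simp add: power2_eq_square)+
  have "star ?a * ?a = 1 - star ?c * ?c"
    using pol_su_relations(4) by (simp add: eq_diff_eq)
  then have aa: "star ?a * ?a \<in> pol_so" using gen pol_so_simps by simp
  have "star ?c * star ?a = 0" "?c * star ?a = 0"
    using arg_cong[OF pol_su_relations(1), of star] arg_cong[OF pol_su_relations(2), of star]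
    by (simp_all add: star_mult star_zero star_star)
  moreover have "star ?a * star ?a \<in> pol_so" "star ?c * star ?c \<in> pol_so"
    "star ?a * star ?c \<in> pol_so" "star ?a * ?c \<in> pol_so"
    using gen(1-4)[THEN pol_so_simps(5)] by (simp_all add: star_mult star_star)
  ultimately show ?thesis
    using assms gen aa by (auto simp: su_letters_def pol_su_relations pol_so_simps)
qed

text \<open>
  Inserting \<open>\<alpha>\<alpha>\<^sup>* = 1\<close> turns a product of two factors of odd length into one of two factors of even
  length.
\<close>

lemma insert_alpha: "x * y = (x * su_alpha) * (star su_alpha * y)"
  by (metis mult.assoc mult_1_left pol_su_relations(5))

lemma alpha_letters: "su_alpha \<in> su_letters" "star su_alpha \<in> su_letters"
  by (simp_all add: su_letters_def)

text \<open>Two further letters preserve even degree. In the product case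
  \<open>insert_alpha\<close> supplies the missing inner letters, so the induction must range over
  all \<open>g\<close> and \<open>g'\<close>.\<close>

lemma pol_so_sandwich:
  assumes "x \<in> pol_so" "g \<in> su_letters" "g' \<in> su_letters"
  shows "g * x * g' \<in> pol_so"
  using assms unfolding pol_so_def
proof (induction arbitrary: g g')
  case (gen x)
  \<comment> \<open>A generator is split into its two letters, so that \<open>g * u\<close> and
    \<open>w * g'\<close> are even separately.\<close>
  then obtain u w where "u \<in> su_letters" "w \<in> su_letters" "x = u * w"
    by (auto simp: su_letters_def power2_eq_square)
  then show ?case
    using su_letters_mult[of g u] su_letters_mult[of w g'] gen pol_so_simps(3)[of "g * u" "w * g'"]
    unfolding pol_so_def by (simp add: mult.assoc)
next
  case one
  then show ?case using su_letters_mult unfolding pol_so_def by simp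
next
  case (add x y)
  then show ?case by (simp add: distrib_left distrib_right star_subalgebra.add)
next
  case (scale x c)
  then show ?case by (simp add: mult_scaleC_left mult_scaleC_right star_subalgebra.scale)
next
  case (mult x y)
  have "g * (x * y) * g' = (g * x * su_alpha) * (star su_alpha * y * g')"
    using insert_alpha[of "g * x" "y * g'"] by (simp add: mult.assoc)
  then show ?case
    using star_subalgebra.mult[OF mult.IH(1)[OF mult.prems(1) alpha_letters(1)]
        mult.IH(2)[OF alpha_letters(2) mult.prems(2)]]
    by simp
next
  case (star x)
  then have "star (star g' * x * star g) \<in> pol_so"
    unfolding pol_so_def by (intro star_subalgebra.star star.IH star_su_letters)
  then show ?case unfolding pol_so_def by (simp add: star_mult star_star mult.assoc)
qed

text \<open>Oddness is expressed by the products with letters rather than by spans of odd words, so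
  that its closure properties reduce to those of \<open>pol_so\<close>.\<close>

definition pol_odd :: "pol_su set" where
  "pol_odd = {x. \<forall>g\<in>su_letters. x * g \<in> pol_so \<and> g * x \<in> pol_so}"

lemma pol_odd_closed:
  "x \<in> pol_odd \<Longrightarrow> y \<in> pol_odd \<Longrightarrow> x + y \<in> pol_odd"
  "x \<in> pol_odd \<Longrightarrow> c *\<^sub>C x \<in> pol_odd"
  "x \<in> pol_odd \<Longrightarrow> star x \<in> pol_odd" "0 \<in> pol_odd"
proof -
  show "star x \<in> pol_odd" if "x \<in> pol_odd"
    using that pol_so_simps(5) star_su_letters
    unfolding pol_odd_def by (auto simp: star_mult) (metis star_mult star_star)+
qed (simp_all add: pol_odd_def pol_so_simps distrib_left distrib_right mult_scaleC_left
      mult_scaleC_right)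

lemma pol_odd_mult:
  assumes "x \<in> pol_odd"
  shows "y \<in> pol_odd \<Longrightarrow> x * y \<in> pol_so" "y \<in> pol_so \<Longrightarrow> x * y \<in> pol_odd"
    "y \<in> pol_so \<Longrightarrow> y * x \<in> pol_odd"
proof -
  have x: "x * g \<in> pol_so" "g * x \<in> pol_so" if "g \<in> su_letters" for g
    using that assms by (auto simp: pol_odd_def)
  show "x * y \<in> pol_so" if "y \<in> pol_odd"
    using pol_so_simps(3)[OF x(1)[OF alpha_letters(1)], of "star su_alpha * y"] that alpha_letters(2)
    unfolding insert_alpha[of x y] by (simp add: pol_odd_def)
  show "x * y \<in> pol_odd" if y: "y \<in> pol_so"
  proof -
    \<comment> \<open>The factor \<open>x * su_alpha\<close> is even because \<open>x\<close> is
      odd; the other one is the even \<open>y\<close> between two letters.\<close>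
    have "(x * su_alpha) * (star su_alpha * y * g) \<in> pol_so" "(g * x) * y \<in> pol_so"
      if "g \<in> su_letters" for g
      by (simp_all add: pol_so_simps(3) x pol_so_sandwich alpha_letters that y)
    then show ?thesis
      using insert_alpha[of x "y * _"] by (auto simp: pol_odd_def mult.assoc)
  qed
  show "y * x \<in> pol_odd" if y: "y \<in> pol_so"
  proof -
    have "(g * y * su_alpha) * (star su_alpha * x) \<in> pol_so" "y * (x * g) \<in> pol_so"
      if "g \<in> su_letters" for g
      by (simp_all add: pol_so_simps(3) x pol_so_sandwich alpha_letters that y)
    then show ?thesis
      using insert_alpha[of "_ * y" x] by (auto simp: pol_odd_def mult.assoc)
  qed
qed

text \<open>The generators are odd, and the parity rules sort the four terms of a product of two
  sums.\<close>

lemma pol_su_even_odd: "\<exists>y\<in>pol_so. \<exists>z\<in>pol_odd. x = y + z"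
  using pol_su_generated[of x]
proof induction
  case (gen x)
  then have "x \<in> pol_odd" by (auto simp: pol_odd_def su_letters_mult su_letters_def)
  then show ?case using pol_so_simps(6) by force
next
  case one
  then show ?case using pol_so_simps(1) pol_odd_closed(4) by force
next
  case (add x y)
  then obtain a b a' b' where "a \<in> pol_so" "b \<in> pol_odd" "a' \<in> pol_so" "b' \<in> pol_odd"
    "x = a + b" "y = a' + b'" by blast
  then show ?case
    by (intro bexI[of _ "a + a'"] bexI[of _ "b + b'"]) (simp_all add: pol_so_simps pol_odd_closed)
next
  case (scale x c)
  then show ?case using pol_so_simps(4) pol_odd_closed(2) by (metis scaleC_add_right)
next
  case (mult x y)
  then obtain a b a' b' where *: "a \<in> pol_so" "b \<in> pol_odd" "a' \<in> pol_so" "b' \<in> pol_odd"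
    "x = a + b" "y = a' + b'" by blast
  then have "a * a' + b * b' \<in> pol_so" "a * b' + b * a' \<in> pol_odd"
    by (simp_all add: pol_so_simps pol_odd_closed pol_odd_mult)
  moreover have "x * y = (a * a' + b * b') + (a * b' + b * a')"
    by (simp add: * algebra_simps)
  ultimately show ?case by blast
next
  case (star x)
  then show ?case using pol_so_simps(5) pol_odd_closed(3) by (metis star_add)
qed

text \<open>Here \<open>x\<close> equals \<open>su_alpha * (star su_alpha * x)\<close>, where the
  second factor is even and the first changes sign.\<close>

lemma sign_aut_pol_odd:
  assumes "x \<in> pol_odd"
  shows "sign_aut (to_completion x) = - to_completion x"
proof -
  have "star su_alpha * x \<in> pol_so" using assms alpha_letters by (simp add: pol_odd_def)
  then have "sign_aut (to_completion (star su_alpha * x)) = to_completion (star su_alpha * x)"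
    by (rule sign_aut_pol_so)
  moreover have "to_completion x = c_alpha * to_completion (star su_alpha * x)"
    using insert_alpha[of 1 x]
    by (simp add: c_alpha_def flip: unital_star_homD[OF to_completion_hom])
  ultimately show ?thesis by (simp add: sign_aut_simps)
qed

text \<open>For a polynomial only the even summand remains, which lies in \<open>pol_so\<close>;
  density and continuity extend this to all of \<open>c_su\<close>.\<close>

lemma even_part_in_c_so: "even_part x \<in> c_so"
proof -
  have "even_part (to_completion x) \<in> to_completion ` pol_so" for x
  proof -
    obtain y z where yz: "y \<in> pol_so" "z \<in> pol_odd" "x = y + z" using pol_su_even_odd by blast
    have "even_part (to_completion z) = 0"
      by (simp add: even_part_def sign_aut_pol_odd yz)
    then have "even_part (to_completion x) = to_completion y"
      by (simp add: yz unital_star_homD[OF to_completion_hom] even_part_add even_part_fixed sign_aut_pol_so)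
    then show ?thesis using yz by blast
  qed
  then have "even_part ` range to_completion \<subseteq> to_completion ` pol_so" by blast
  then have "even_part ` closure (range to_completion) \<subseteq> c_so"
    unfolding c_so_def
    by (intro image_closure_subset continuous_on_even_part closed_closure)
       (meson closure_subset order_trans)
  then show ?thesis unfolding closure_range_to_completion by blast
qed

text \<open>Membership in the closure \<open>c_so\<close> becomes an algebraic test, from which
  closure under products and adjoints is immediate.\<close>

lemma c_so_eq_fixed_points: "x \<in> c_so \<longleftrightarrow> sign_aut x = x"
  using sign_aut_c_so even_part_in_c_so[of x] even_part_fixed[of x] by auto

section \<open>Extension of idempotent states\<close>

lemma comult_hom: "unital_star_hom comult"
  and comult_alpha: "comult c_alpha = c_alpha \<otimes> c_alpha"
  and comult_gamma: "comult c_gamma = c_gamma \<otimes> c_alpha + star c_alpha \<otimes> c_gamma"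
  using theI'[OF comult_unique_existence] unfolding comult_def by simp_all

text \<open>Positivity is the point, since \<open>f\<close> is known to be positive only on
  \<open>star y * y\<close> with \<open>y\<close> in \<open>c_so\<close>. The even part of
  \<open>star x * x\<close> is written as a sum of two such elements.\<close>

lemma state_on_even_part:
  assumes f: "state_on c_so f"
  shows "state_on UNIV (\<lambda>x. f (even_part x))"
proof -
  have lin: "f (x + y) = f x + f y" "f (c *\<^sub>C x) = c * f x" if "x \<in> c_so" "y \<in> c_so" for x y c
    using f that unfolding state_on_def clinear_on_def by blast+
  have pos: "f (star x * x) \<in> \<real>\<^sub>\<ge>\<^sub>0" if "x \<in> c_so" for x
    using f that unfolding state_on_def by blast
  have "f (even_part (star x * x)) \<in> \<real>\<^sub>\<ge>\<^sub>0" for x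
  proof -
    define y where "y = even_part x"
    define z where "z = x - y"
    \<comment> \<open>The odd part of \<open>x\<close> becomes even after multiplication by the isometry \<open>\<alpha>\<^sup>*\<close>.\<close>
    define u where "u = star c_alpha * z"
    have s: "sign_aut y = y" by (simp add: y_def sign_aut_even_part)
    have sz: "sign_aut z = - z"
    proof -
      have "x + sign_aut x = y + y" by (simp add: y_def even_part_def flip: scaleR_left_distrib)
      then have "sign_aut x = y + y - x" by (simp add: eq_diff_eq add.commute)
      then show ?thesis by (simp add: z_def sign_aut_simps s)
    qed
    then have u: "sign_aut u = u" by (simp add: u_def sign_aut_simps star_uminus)
    have "star u * u = star z * (c_alpha * star c_alpha) * z"
      by (simp only: u_def star_mult star_star mult.assoc)
    then have zz: "star z * z = star u * u" by (simp add: to_completion_relations)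
    have "x = y + z" by (simp add: z_def)
    \<comment> \<open>As \<open>sign_aut x = y - z\<close>, the mixed terms in \<open>y\<close> and
      \<open>z\<close> cancel.\<close>
    then have "star x * x + sign_aut (star x * x) = 2 *\<^sub>R (star y * y + star z * z)"
      by (simp add: sign_aut_simps s sz star_add star_uminus algebra_simps scaleR_2)
    then have "even_part (star x * x) = star y * y + star u * u"
      by (simp add: even_part_def zz)
    moreover have "y \<in> c_so" "u \<in> c_so" "star y * y \<in> c_so" "star u * u \<in> c_so"
      by (simp_all add: c_so_eq_fixed_points sign_aut_simps s u)
    ultimately show ?thesis using pos lin(1) by (simp add: nonneg_Reals_add_I)
  qed
  moreover have "f (even_part 1) = 1"
    using f by (simp add: even_part_fixed sign_aut_simps state_on_def)
  ultimately show ?thesis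
    unfolding state_on_def clinear_on_def
    by (simp add: even_part_add even_part_scaleC lin(1) lin(2)[OF _ even_part_in_c_so]
        even_part_in_c_so)
qed

lemma idempotent_state_extends:
  assumes f: "idempotent_state c_so comult f"
  shows "idempotent_state UNIV comult (\<lambda>x. f (even_part x))"
proof -
  obtain F where F: "clinear_on (tensor_square c_so) F" "continuous_on (tensor_square c_so) F"
    "\<And>a b. a \<in> c_so \<Longrightarrow> b \<in> c_so \<Longrightarrow> F (a \<otimes> b) = f a * f b"
    "\<And>x. x \<in> c_so \<Longrightarrow> F (comult x) = f x"
    using f unfolding idempotent_state_def by blast
  obtain S :: "(c_su, c_su) cstar_tensor \<Rightarrow> (c_su, c_su) cstar_tensor"
    where S: "unital_star_hom S" "\<And>a b. S (a \<otimes> b) = sign_aut a \<otimes> b"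
    using tensor_automorphism_exists[OF sign_aut_hom unital_star_hom_id sign_aut_involutive] by blast
  obtain T :: "(c_su, c_su) cstar_tensor \<Rightarrow> (c_su, c_su) cstar_tensor"
    where T: "unital_star_hom T" "\<And>a b. T (a \<otimes> b) = a \<otimes> sign_aut b"
    using tensor_automorphism_exists[OF unital_star_hom_id sign_aut_hom _ sign_aut_involutive] by blast
  \<comment> \<open>\<open>P\<close> is the tensor square of \<open>even_part\<close>. As
    \<open>even_part\<close> is not multiplicative, \<open>P\<close> is assembled from the
    automorphisms \<open>S\<close> and \<open>T\<close>, which act on one leg each.\<close>
  define P where "P x = (1 / 4) *\<^sub>R ((x + S x) + T (x + S x))" for x
  have lin: "P (x + y) = P x + P y" "P (c *\<^sub>C x) = c *\<^sub>C P x" for x y c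
    by (simp_all add: P_def unital_star_homD[OF S(1)] unital_star_homD[OF T(1)] algebra_simps
        scaleR_scaleC scaleC_scaleC mult.commute[of c] scaleC_add_right)
  have linR: "linear P"
    by (rule linearI) (simp_all add: lin scaleR_scaleC)
  have cont: "continuous_on A P" for A
    unfolding P_def
    by (intro continuous_intros continuous_on_compose2[OF unital_star_hom_continuous[OF T(1), of UNIV]]
        unital_star_hom_continuous[OF S(1)]) auto
  have tR: "(r *\<^sub>R a) \<otimes> b = r *\<^sub>R (a \<otimes> b)" "a \<otimes> (r *\<^sub>R b) = r *\<^sub>R (a \<otimes> b)"
    for r and a b :: c_su
    by (simp_all add: scaleR_scaleC tensor_simps)
  have P: "P (a \<otimes> b) = even_part a \<otimes> even_part b" for a b
    by (simp add: P_def even_part_def S(2) T(2) unital_star_homD[OF T(1)] tensor_simps tR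
        algebra_simps)
  \<comment> \<open>Elementary tensors go to elementary tensors over \<open>c_so\<close>; real
    linearity passes to the span, continuity to its closure.\<close>
  have into: "P ` tensor_square UNIV \<subseteq> tensor_square c_so"
  proof -
    have "P ` span {a \<otimes> b |a b. a \<in> UNIV \<and> b \<in> UNIV} = span (P ` {a \<otimes> b |a b. a \<in> UNIV \<and> b \<in> UNIV})"
      by (rule linear_span_image[OF linR, symmetric])
    also have "\<dots> \<subseteq> span {a \<otimes> b |a b. a \<in> c_so \<and> b \<in> c_so}"
      using even_part_in_c_so by (intro span_mono) (auto simp: P, blast)
    finally have "P ` span {a \<otimes> b |a b. a \<in> UNIV \<and> b \<in> UNIV} \<subseteq> tensor_square c_so"
      unfolding tensor_square_def using closure_subset by (rule order_trans)
    then show ?thesis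
      unfolding tensor_square_def[of UNIV]
      by (intro image_closure_subset cont) (simp_all add: tensor_square_def)
  qed
  have t0: "(- a) \<otimes> b = - (a \<otimes> b)" "a \<otimes> (- b) = - (a \<otimes> b)" for a b :: c_su
    using tensor_simps(3)[of "- 1" a b] tensor_simps(4)[of a "- 1" b] by (simp_all add: scaleC_minus_one)
  \<comment> \<open>Each summand of the coproduct of a generator has exactly one letter in either
    leg, so \<open>S\<close>, and likewise \<open>T\<close>, negates it.\<close>
  have "(\<lambda>x. S (comult x)) = (\<lambda>x. comult (sign_aut x))"
    by (rule c_su_hom_unique)
       (simp_all add: unital_star_hom_comp S(1) comult_hom sign_aut_hom comult_alpha comult_gamma
         sign_aut_simps unital_star_homD[OF comult_hom] unital_star_homD[OF S(1)] S(2) t0 star_uminus)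
  then have SD: "S (comult x) = comult (sign_aut x)" for x by (rule fun_cong)
  have "(\<lambda>x. T (comult x)) = (\<lambda>x. comult (sign_aut x))"
    by (rule c_su_hom_unique)
       (simp_all add: unital_star_hom_comp T(1) comult_hom sign_aut_hom comult_alpha comult_gamma
         sign_aut_simps unital_star_homD[OF comult_hom] unital_star_homD[OF T(1)] T(2) t0)
  then have TD: "T (comult x) = comult (sign_aut x)" for x by (rule fun_cong)
  \<comment> \<open>Applying both \<open>S\<close> and \<open>T\<close> to \<open>comult x\<close>
    gives it back, so the four terms of \<open>P\<close> agree in pairs.\<close>
  have PD: "P (comult x) = comult (even_part x)" for x
  proof -
    have "P (comult x) = (1 / 4) *\<^sub>R (2 *\<^sub>R (comult x + comult (sign_aut x)))"
      by (simp add: P_def SD TD unital_star_homD[OF T(1)] sign_aut_involutive scaleR_2 algebra_simps)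
    then show ?thesis
      by (simp add: even_part_def scaleR_scaleC scaleC_scaleC unital_star_homD[OF comult_hom])
  qed
  have "clinear_on (tensor_square UNIV) (\<lambda>x. F (P x))"
    using F(1) into unfolding clinear_on_def by (auto simp: lin image_subset_iff)
  moreover have "continuous_on (tensor_square UNIV) (\<lambda>x. F (P x))"
    by (rule continuous_on_compose2[OF F(2) cont into])
  moreover have "state_on UNIV (\<lambda>x. f (even_part x))"
    using f unfolding idempotent_state_def by (intro state_on_even_part) blast
  ultimately show ?thesis
    unfolding idempotent_state_def
    by (intro conjI exI[of _ "\<lambda>x. F (P x)"]) (simp_all add: P PD F(3,4) even_part_in_c_so)
qed

section \<open>Restrictions of the states \<open>\<phi>\<^sub>n\<close>\<close>

lemma circle_map:
  assumes "cmod z = 1"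
  shows circle_map_hom: "unital_star_hom (\<lambda>x. circle_map x z)"
    and circle_map_alpha: "circle_map c_alpha z = z"
    and circle_map_gamma: "circle_map c_gamma z = 0"
  using theI'[OF circle_map_unique_existence, folded circle_map_def] assms by simp_all

text \<open>Both sides are characters of \<open>c_su\<close> in \<open>x\<close> with the same
  values on the generators, namely \<open>- z\<close> and 0.\<close>

lemma circle_map_uminus:
  assumes z: "cmod z = 1"
  shows "circle_map x (- z) = circle_map (sign_aut x) z"
proof -
  have z': "cmod (- z) = 1" using z by simp
  show ?thesis
    by (rule fun_cong[OF c_su_hom_unique[OF circle_map_hom[OF z']
            unital_star_hom_comp[OF circle_map_hom[OF z] sign_aut_hom]]])
       (simp_all add: sign_aut_simps unital_star_homD[OF circle_map_hom[OF z]] circle_map_alpha[OF z]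
         circle_map_gamma[OF z] circle_map_alpha[OF z'] circle_map_gamma[OF z'])
qed

lemma phi_state_double_odd:
  assumes n: "odd n" and x: "x \<in> c_so"
  shows "phi_state n x = phi_state (2 * n) x"
proof -
  let ?R = "{z :: complex. z ^ n = 1}"
  \<comment> \<open>For exponent 0 every complex number would be a root; oddness excludes
    this.\<close>
  have n0: "n > 0" using n by (auto intro: Nat.gr0I)
  have fin: "finite ?R" using n0 by (intro finite_roots_unity) simp
  have norm: "cmod z = 1" if "z \<in> ?R" for z
  proof -
    have "cmod z ^ n = 1" using that by (simp flip: norm_power)
    then show ?thesis using n0 power_eq_imp_eq_base[of "cmod z" n 1] by simp
  qed
  \<comment> \<open>If \<open>z ^ n = - 1\<close>, then \<open>(- z) ^ n = 1\<close> because
    \<open>n\<close> is odd. For the same reason the two sets are disjoint.\<close>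
  have split: "{z :: complex. z ^ (2 * n) = 1} = ?R \<union> uminus ` ?R"
  proof (intro set_eqI iffI)
    fix z :: complex assume "z \<in> {z. z ^ (2 * n) = 1}"
    then have "(z ^ n)\<^sup>2 = 1" by (simp add: mult.commute flip: power_mult)
    then have "z ^ n = 1 \<or> (- z) ^ n = 1" using n by (auto simp: power2_eq_1_iff)
    then show "z \<in> ?R \<union> uminus ` ?R" by (auto intro: image_eqI[of _ _ "- z"])
  qed (auto simp: power_mult power_mult_distrib mult.commute[of 2] n)
  have "(\<Sum>z\<in>uminus ` ?R. circle_map x z) = (\<Sum>z\<in>?R. circle_map x (- z))"
    by (simp add: sum.reindex)
  also have "\<dots> = (\<Sum>z\<in>?R. circle_map x z)"
    by (rule sum.cong) (use norm in \<open>simp_all add: circle_map_uminus sign_aut_c_so[OF x]\<close>)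
  finally have "(\<Sum>z | z ^ (2 * n) = 1. circle_map x z) = 2 * (\<Sum>z\<in>?R. circle_map x z)"
    unfolding split using fin n by (subst sum.union_disjoint) auto
  then show ?thesis by (simp add: phi_state_def)
qed

theorem theorem6p6:
  shows "(\<forall>f. idempotent_state c_so comult f \<longrightarrow>
            (\<exists>g. idempotent_state (UNIV :: c_su set) comult g \<and> (\<forall>x\<in>c_so. g x = f x))) \<and>
         (\<forall>n::nat. odd n \<longrightarrow> (\<forall>x\<in>c_so. phi_state n x = phi_state (2 * n) x))"
proof (intro conjI allI impI ballI)
  fix f assume "idempotent_state c_so comult f"
  then show "\<exists>g. idempotent_state (UNIV :: c_su set) comult g \<and> (\<forall>x\<in>c_so. g x = f x)"
    using idempotent_state_extends
    by (intro exI[of _ "\<lambda>x. f (even_part x)"]) (simp add: even_part_fixed sign_aut_c_so)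
qed (rule phi_state_double_odd)

end
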